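(* If $\mathbb L$ is a suborder of the real line $\mathbb R$ which contains a perfect set, then $\mathbb B_{\mathbb L}\cong\mathbb B_{\mathbb R}\cong\mathrm{ro}(\mathbb S)\cong\mathrm{ro}(\mathrm{Borel}(\mathbb R)/[\mathbb R]^{\le\omega})$.
   Context: For a linear order $\mathbb L$ with domain $L$, $\mathbb P(\mathbb L)=\{f[L]:f$ a self-embedding of $\mathbb L\}$ ordered by $\subset$ and $\mathbb B_{\mathbb L}=\mathrm{ro}(\mathrm{sq}(\mathbb P(\mathbb L)))$ is the Boolean completion of its separative quotient. $\mathbb R$ carries its usual order. $\mathbb S$ is the Sacks forcing: perfect subsets of $\mathbb R$ ordered by inclusion. $\mathrm{Borel}(\mathbb R)/[\mathbb R]^{\le\omega}$ is the algebra of Borel subsets of $\mathbb R$ modulo the ideal of countable sets; $\mathrm{ro}(\mathbb P)$ of a poset (or of a Boolean algebra, via its nonzero elements) is its Boolean completion. *)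

theory Defs
  imports "HOL-Analysis.Analysis"
begin

text \<open>
  A poset is represented by its reflexive order relation \<open>r\<close>, with carrier \<open>Field r\<close>;
  \<open>(p, q) \<in> r\<close> means \<open>p \<le> q\<close>. Boolean algebras are represented in the same way: the order
  determines all Boolean operations, so an isomorphism of Boolean algebras is the same thing
  as an isomorphism of the underlying orders.
\<close>

definition order_isomorphic :: "'a rel \<Rightarrow> 'b rel \<Rightarrow> bool"  (infix \<open>\<cong>\<^sub>o\<close> 50) where
  "r \<cong>\<^sub>o s \<longleftrightarrow>
     (\<exists>f. bij_betw f (Field r) (Field s) \<and>
          (\<forall>p\<in>Field r. \<forall>q\<in>Field r. (p, q) \<in> r \<longleftrightarrow> (f p, f q) \<in> s))"

definition sep_le :: "'a rel \<Rightarrow> 'a rel" where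
  "sep_le r = {(p, q) \<in> Field r \<times> Field r. \<forall>s. (s, p) \<in> r \<longrightarrow> (\<exists>t. (t, s) \<in> r \<and> (t, q) \<in> r)}"

definition sep_eq :: "'a rel \<Rightarrow> 'a rel" where
  "sep_eq r = sep_le r \<inter> (sep_le r)\<inverse>"

definition sq :: "'a rel \<Rightarrow> 'a set rel" where
  "sq r = {(sep_eq r `` {p}, sep_eq r `` {q}) | p q. (p, q) \<in> sep_le r}"

text \<open>
  The separative quotient identifies \<open>p\<close> and \<open>q\<close> when they are compatible with the same
  elements; the Boolean completion consists of the regular open sets of the topology whose
  open sets are the down-closed sets, ordered by inclusion.
\<close>

definition downset_topology :: "'a rel \<Rightarrow> 'a topology" where
  "downset_topology r =
     topology (\<lambda>U. U \<subseteq> Field r \<and> (\<forall>p\<in>U. \<forall>q. (q, p) \<in> r \<longrightarrow> q \<in> U))"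

lemma openin_downset_topology:
  "openin (downset_topology r) U \<longleftrightarrow> U \<subseteq> Field r \<and> (\<forall>p\<in>U. \<forall>q. (q, p) \<in> r \<longrightarrow> q \<in> U)"
proof -
  have "istopology (\<lambda>U. U \<subseteq> Field r \<and> (\<forall>p\<in>U. \<forall>q. (q, p) \<in> r \<longrightarrow> q \<in> U))"
    unfolding istopology_def by blast
  then show ?thesis
    by (simp add: downset_topology_def topology_inverse')
qed

lemma topspace_downset_topology: "topspace (downset_topology r) = Field r"
proof -
  have "openin (downset_topology r) (Field r)"
    by (auto simp: openin_downset_topology Field_def)
  then show ?thesis
    by (meson openin_subset openin_topspace openin_downset_topology subset_antisym)
qed

definition ro :: "'a rel \<Rightarrow> 'a set rel" where
  "ro r = relation_of (\<subseteq>)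
     {U. openin (downset_topology r) U \<and>
         downset_topology r interior_of (downset_topology r closure_of U) = U}"

text \<open>The zero of a Boolean algebra is its least element.\<close>

definition nonzero :: "'a rel \<Rightarrow> 'a rel" where
  "nonzero r = Restr r (Field r - {z. \<forall>x\<in>Field r. (z, x) \<in> r})"

definition copies :: "'a::linorder set \<Rightarrow> 'a set set" where
  "copies L = {f ` L | f. f \<in> L \<rightarrow> L \<and> strict_mono_on L f}"

definition copy_algebra :: "'a::linorder set \<Rightarrow> 'a set set set rel" where
  "copy_algebra L = ro (sq (relation_of (\<subseteq>) (copies L)))"

definition perfect :: "'a::topological_space set \<Rightarrow> bool" where
  "perfect S \<longleftrightarrow> S \<noteq> {} \<and> closed S \<and> (\<forall>x\<in>S. x islimpt S)"

definition sacks :: "real set rel" where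
  "sacks = relation_of (\<subseteq>) {S. perfect S}"

definition eq_mod_countable :: "real set rel" where
  "eq_mod_countable = {(A, B) \<in> sets borel \<times> sets borel. countable (sym_diff A B)}"

definition borel_mod_countable :: "real set set rel" where
  "borel_mod_countable =
     {(eq_mod_countable `` {A}, eq_mod_countable `` {B}) | A B.
        A \<in> sets borel \<and> B \<in> sets borel \<and> countable (A - B)}"

end

theory Submission
  imports Defs
begin

text \<open>
  A map between preorders that preserves order and incompatibility and has dense range induces an
  isomorphism of Boolean completions; this covers separative quotients, dense suborders and the map
  \<open>P \<mapsto> [P]\<close> from perfect sets to Borel sets modulo countable sets, whose range is dense because
  every uncountable Borel set contains a perfect set.

  A strictly increasing map is continuous on a perfect set off a countable set, so every copy of
  \<open>L\<close> contains a perfect set; conversely \<open>\<real>\<close>, hence \<open>L\<close>, embeds into every perfect set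
  through the lexicographically ordered Cantor space. Thus the copies of \<open>L\<close> and the perfect subsets
  of \<open>L\<close> are both dense in their union. To compare the perfect subsets of \<open>L\<close> with those of
  \<open>\<real>\<close>, take in each case a maximal family of Cantor sets of which no two share a perfect subset.
  It can be chosen of size continuum, because a Cantor set splits into continuum many disjoint ones,
  and the perfect sets below its members are dense. Matching the members of the two families by
  homeomorphisms gives an isomorphism of these dense suborders.
\<close>

section \<open>Boolean completions and dense maps\<close>

lemma order_isomorphic_sym:
  assumes "r \<cong>\<^sub>o s" shows "s \<cong>\<^sub>o r"
proof -
  obtain f where f: "bij_betw f (Field r) (Field s)"
    "\<And>p q. p \<in> Field r \<Longrightarrow> q \<in> Field r \<Longrightarrow> (p, q) \<in> r \<longleftrightarrow> (f p, f q) \<in> s"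
    using assms by (auto simp: order_isomorphic_def)
  let ?g = "inv_into (Field r) f"
  have "bij_betw ?g (Field s) (Field r)"
    by (rule bij_betw_inv_into[OF f(1)])
  moreover have "(p, q) \<in> s \<longleftrightarrow> (?g p, ?g q) \<in> r" if "p \<in> Field s" "q \<in> Field s" for p q
  proof -
    have "?g p \<in> Field r" "?g q \<in> Field r"
      using bij_betwE[OF bij_betw_inv_into[OF f(1)]] that by auto
    then show ?thesis
      using f(2) bij_betw_inv_into_right[OF f(1)] that by simp
  qed
  ultimately show ?thesis
    unfolding order_isomorphic_def by blast
qed

lemma order_isomorphic_trans [trans]:
  assumes "r \<cong>\<^sub>o s" "s \<cong>\<^sub>o t" shows "r \<cong>\<^sub>o t"
proof -
  obtain f g where f: "bij_betw f (Field r) (Field s)"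
      "\<And>p q. p \<in> Field r \<Longrightarrow> q \<in> Field r \<Longrightarrow> (p, q) \<in> r \<longleftrightarrow> (f p, f q) \<in> s"
    and g: "bij_betw g (Field s) (Field t)"
      "\<And>p q. p \<in> Field s \<Longrightarrow> q \<in> Field s \<Longrightarrow> (p, q) \<in> s \<longleftrightarrow> (g p, g q) \<in> t"
    using assms by (auto simp: order_isomorphic_def)
  have "bij_betw (g \<circ> f) (Field r) (Field t)"
    using f(1) g(1) by (rule bij_betw_trans)
  moreover have "(p, q) \<in> r \<longleftrightarrow> ((g \<circ> f) p, (g \<circ> f) q) \<in> t" if "p \<in> Field r" "q \<in> Field r" for p q
    using f g that by (metis bij_betwE comp_apply)
  ultimately show ?thesis
    unfolding order_isomorphic_def by blast
qed

text \<open>The principal down-set of \<open>p\<close> is the smallest open set containing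
  \<open>p\<close>, so testing against it alone decides membership in a closure, and likewise in an
  interior.\<close>

lemma closure_of_downset_topology:
  assumes "refl_on (Field r) r" "trans r" "U \<subseteq> Field r"
  shows "downset_topology r closure_of U = {p \<in> Field r. \<exists>q. (q, p) \<in> r \<and> q \<in> U}"
proof (intro equalityI subsetI)
  fix p assume p: "p \<in> downset_topology r closure_of U"
  have "openin (downset_topology r) {q. (q, p) \<in> r}"
    using assms(2) by (auto simp: openin_downset_topology Field_def dest: transD)
  moreover have pf: "p \<in> Field r"
    using p by (auto simp: in_closure_of topspace_downset_topology)
  moreover have "(p, p) \<in> r"
    using assms(1) pf by (simp add: refl_onD)
  moreover have "\<forall>T. p \<in> T \<and> openin (downset_topology r) T \<longrightarrow> (\<exists>q. q \<in> U \<and> q \<in> T)"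
    using p by (simp add: in_closure_of)
  ultimately have "\<exists>q. q \<in> U \<and> (q, p) \<in> r"
    by (metis mem_Collect_eq)
  with pf show "p \<in> {p \<in> Field r. \<exists>q. (q, p) \<in> r \<and> q \<in> U}" by blast
next
  fix p assume "p \<in> {p \<in> Field r. \<exists>q. (q, p) \<in> r \<and> q \<in> U}"
  then show "p \<in> downset_topology r closure_of U"
    unfolding in_closure_of by (auto simp: topspace_downset_topology openin_downset_topology)
qed

lemma interior_of_downset_topology:
  assumes "refl_on (Field r) r" "trans r"
  shows "downset_topology r interior_of U = {p \<in> Field r. \<forall>q. (q, p) \<in> r \<longrightarrow> q \<in> U}"
proof (intro equalityI subsetI)
  fix p assume "p \<in> downset_topology r interior_of U"
  then show "p \<in> {p \<in> Field r. \<forall>q. (q, p) \<in> r \<longrightarrow> q \<in> U}"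
    unfolding interior_of_def openin_downset_topology by blast
next
  fix p assume p: "p \<in> {p \<in> Field r. \<forall>q. (q, p) \<in> r \<longrightarrow> q \<in> U}"
  have "openin (downset_topology r) {q. (q, p) \<in> r}"
    using assms(2) by (auto simp: openin_downset_topology Field_def dest: transD)
  moreover have "(p, p) \<in> r"
    using assms(1) p by (simp add: refl_onD)
  ultimately show "p \<in> downset_topology r interior_of U"
    using p unfolding interior_of_def by blast
qed

text \<open>Regular openness without topology: \<open>U\<close> contains \<open>p\<close> exactly
  when \<open>U\<close> is dense below \<open>p\<close>. For reflexive transitive \<open>r\<close>
  this matches \<open>ro\<close>, by \<open>ro_eq_regular_down\<close>.\<close>

definition regular_down :: "'a rel \<Rightarrow> 'a set \<Rightarrow> bool" where
  "regular_down r U \<longleftrightarrow>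
     U \<subseteq> Field r \<and>
     (\<forall>p\<in>Field r. p \<in> U \<longleftrightarrow> (\<forall>q. (q, p) \<in> r \<longrightarrow> (\<exists>s. (s, q) \<in> r \<and> s \<in> U)))"

lemma regular_down_closed:
  assumes "trans r" "regular_down r U" "p \<in> U" "(q, p) \<in> r"
  shows "q \<in> U"
proof -
  have "q \<in> Field r" "p \<in> Field r" using assms(4) by (auto simp: Field_def)
  then show ?thesis
    using assms unfolding regular_down_def by (meson transD)
qed

lemma regular_downI:
  assumes "refl_on (Field r) r" "U \<subseteq> Field r"
    and "\<And>p q. p \<in> U \<Longrightarrow> (q, p) \<in> r \<Longrightarrow> q \<in> U"
    and "\<And>p. p \<in> Field r \<Longrightarrow> (\<And>q. (q, p) \<in> r \<Longrightarrow> \<exists>s. (s, q) \<in> r \<and> s \<in> U) \<Longrightarrow> p \<in> U"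
  shows "regular_down r U"
  unfolding regular_down_def
proof (intro conjI ballI iffI allI impI)
  fix p q assume "p \<in> U" "(q, p) \<in> r"
  then have "q \<in> U" by (rule assms(3))
  moreover have "(q, q) \<in> r"
    using assms(1) \<open>(q, p) \<in> r\<close> by (metis FieldI1 refl_onD)
  ultimately show "\<exists>s. (s, q) \<in> r \<and> s \<in> U" by blast
qed (use assms in blast)+

lemma ro_eq_regular_down:
  assumes "refl_on (Field r) r" "trans r"
  shows "ro r = relation_of (\<subseteq>) {U. regular_down r U}"
proof -
  have "openin (downset_topology r) U \<and>
        downset_topology r interior_of (downset_topology r closure_of U) = U \<longleftrightarrow> regular_down r U"
    for U
  proof
    assume "openin (downset_topology r) U \<and>
        downset_topology r interior_of (downset_topology r closure_of U) = U"
    then have sub: "U \<subseteq> Field r" and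
      "downset_topology r interior_of (downset_topology r closure_of U) = U"
      by (auto simp: openin_downset_topology)
    then have *: "{p \<in> Field r. \<forall>q. (q, p) \<in> r \<longrightarrow> q \<in> {p \<in> Field r. \<exists>q. (q, p) \<in> r \<and> q \<in> U}} = U"
      by (simp only: interior_of_downset_topology[OF assms] closure_of_downset_topology[OF assms sub])
    show "regular_down r U"
      unfolding regular_down_def
    proof (intro conjI ballI sub)
      fix p assume p: "p \<in> Field r"
      have "p \<in> U \<longleftrightarrow> p \<in> {p \<in> Field r. \<forall>q. (q, p) \<in> r \<longrightarrow> q \<in> {p \<in> Field r. \<exists>q. (q, p) \<in> r \<and> q \<in> U}}"
        by (simp only: *)
      with p show "p \<in> U \<longleftrightarrow> (\<forall>q. (q, p) \<in> r \<longrightarrow> (\<exists>s. (s, q) \<in> r \<and> s \<in> U))"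
        by (auto simp: FieldI1)
    qed
  next
    assume U: "regular_down r U"
    then have sub: "U \<subseteq> Field r" by (simp add: regular_down_def)
    have "openin (downset_topology r) U"
      using regular_down_closed[OF assms(2) U] sub by (auto simp: openin_downset_topology)
    moreover have "{p \<in> Field r. \<forall>q. (q, p) \<in> r \<longrightarrow> q \<in> {p \<in> Field r. \<exists>q. (q, p) \<in> r \<and> q \<in> U}} = U"
      using U sub unfolding regular_down_def by (auto simp: FieldI1)
    ultimately show "openin (downset_topology r) U \<and>
        downset_topology r interior_of (downset_topology r closure_of U) = U"
      by (simp only: interior_of_downset_topology[OF assms] closure_of_downset_topology[OF assms sub])
  qed
  then show ?thesis by (simp add: ro_def)
qed

lemma Field_relation_of: "(\<And>x. x \<in> A \<Longrightarrow> R x x) \<Longrightarrow> Field (relation_of R A) = A"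
  by (auto simp: relation_of_def Field_def)

lemma refl_on_relation_of_subset: "refl_on (Field (relation_of (\<subseteq>) F)) (relation_of (\<subseteq>) F)"
  by (subst Field_relation_of) (auto simp: relation_of_def refl_on_def)

lemma trans_relation_of_subset: "trans (relation_of (\<subseteq>) F)"
  by (auto simp: relation_of_def trans_def)

text \<open>A regular set in \<open>s\<close> is determined by its trace on the dense range of
  \<open>e\<close>, so pulling back along \<open>e\<close> loses nothing. Hypothesis
  \<open>compat\<close> says that \<open>e\<close> preserves incompatibility, and it makes the
  pulled back sets regular again.\<close>

lemma ro_iso_of_dense_map:
  fixes r :: "'a rel" and s :: "'b rel" and e :: "'a \<Rightarrow> 'b"
  assumes r: "refl_on (Field r) r" "trans r" and s: "refl_on (Field s) s" "trans s"
    and mono: "\<And>p q. (p, q) \<in> r \<Longrightarrow> (e p, e q) \<in> s"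
    and compat: "\<And>p q t. p \<in> Field r \<Longrightarrow> q \<in> Field r \<Longrightarrow> (t, e p) \<in> s \<Longrightarrow> (t, e q) \<in> s \<Longrightarrow>
                   \<exists>u. (u, p) \<in> r \<and> (u, q) \<in> r"
    and dense: "\<And>q. q \<in> Field s \<Longrightarrow> \<exists>p\<in>Field r. (e p, q) \<in> s"
  shows "ro r \<cong>\<^sub>o ro s"
proof -
  define F where "F V = {q \<in> Field s. \<forall>p\<in>Field r. (e p, q) \<in> s \<longrightarrow> p \<in> V}" for V
  define G where "G U = {p \<in> Field r. e p \<in> U}" for U
  have eF: "e p \<in> Field s" if "p \<in> Field r" for p
    using that r(1) mono by (metis FieldI1 refl_onD)
  have rr: "(p, p) \<in> r" if "p \<in> Field r" for p
    using that r(1) by (simp add: refl_onD)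
  have ss: "(p, p) \<in> s" if "p \<in> Field s" for p
    using that s(1) by (simp add: refl_onD)
  have FieldD: "p \<in> Field r" "q \<in> Field r" if "(p, q) \<in> r" for p q
    using that by (auto simp: Field_def)
  have FieldD': "p \<in> Field s" "q \<in> Field s" if "(p, q) \<in> s" for p q
    using that by (auto simp: Field_def)
  have regF: "regular_down s (F V)" if V: "regular_down r V" for V
  proof (rule regular_downI)
    show "q \<in> F V" if "p \<in> F V" "(q, p) \<in> s" for p q
      using that s(2) FieldD' unfolding F_def by (blast dest: transD)
    show "q \<in> F V" if q: "q \<in> Field s" and *: "\<And>q'. (q', q) \<in> s \<Longrightarrow> \<exists>w. (w, q') \<in> s \<and> w \<in> F V" for q
      unfolding F_def
    proof (intro CollectI conjI ballI impI q)
      fix p assume p: "p \<in> Field r" "(e p, q) \<in> s"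
      \<comment> \<open>Since \<open>V\<close> is regular, it suffices that \<open>V\<close> is
        dense below \<open>p\<close>. An image \<open>e u\<close> with \<open>u\<close> in
        \<open>V\<close> is found below \<open>e p'\<close>, and \<open>compat\<close> replaces it
        by a common lower bound of \<open>u\<close> and \<open>p'\<close> in
        \<open>r\<close>.\<close>
      have "\<exists>w. (w, p') \<in> r \<and> w \<in> V" if p': "(p', p) \<in> r" for p'
      proof -
        have "(e p', q) \<in> s" using mono[OF p'] p(2) s(2) by (meson transD)
        from *[OF this] obtain w where w: "(w, e p') \<in> s" "w \<in> F V" by blast
        obtain u where u: "u \<in> Field r" "(e u, w) \<in> s" using dense FieldD'[OF w(1)] by blast
        have "u \<in> V" using w(2) u by (simp add: F_def)
        moreover have "(e u, e p') \<in> s" using u(2) w(1) s(2) by (meson transD)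
        ultimately obtain v where "(v, u) \<in> r" "(v, p') \<in> r"
          using compat[of u p' "e u"] u(1) FieldD[OF p'] ss eF by blast
        then show ?thesis using regular_down_closed[OF r(2) V \<open>u \<in> V\<close>] by blast
      qed
      then show "p \<in> V" using V p(1) unfolding regular_down_def by blast
    qed
  qed (auto simp: F_def s)
  have regG: "regular_down r (G U)" if U: "regular_down s U" for U
  proof (rule regular_downI)
    show "q \<in> G U" if "p \<in> G U" "(q, p) \<in> r" for p q
      using that FieldD mono regular_down_closed[OF s(2) U] unfolding G_def by blast
    show "p \<in> G U" if p: "p \<in> Field r" and *: "\<And>q. (q, p) \<in> r \<Longrightarrow> \<exists>w. (w, q) \<in> r \<and> w \<in> G U" for p
    proof -
      have "\<exists>w. (w, q) \<in> s \<and> w \<in> U" if q: "(q, e p) \<in> s" for q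
      proof -
        obtain u where u: "u \<in> Field r" "(e u, q) \<in> s" using dense FieldD'[OF q] by blast
        have "(e u, e p) \<in> s" using u(2) q s(2) by (meson transD)
        then obtain v where v: "(v, u) \<in> r" "(v, p) \<in> r"
          using compat[of u p "e u"] u(1) p ss eF by blast
        obtain w where w: "(w, v) \<in> r" "w \<in> G U" using *[OF v(2)] by blast
        have "(e w, q) \<in> s"
          using mono[OF w(1)] mono[OF v(1)] u(2) s(2) by (meson transD)
        then show ?thesis using w(2) by (auto simp: G_def)
      qed
      then have "e p \<in> U" using U eF[OF p] unfolding regular_down_def by blast
      then show ?thesis using p by (simp add: G_def)
    qed
  qed (auto simp: G_def r)
  have GF: "G (F V) = V" if V: "regular_down r V" for V
  proof (intro equalityI subsetI)
    fix p assume "p \<in> G (F V)"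
    then show "p \<in> V" using ss eF by (auto simp: G_def F_def)
  next
    fix p assume p: "p \<in> V"
    then have pF: "p \<in> Field r" using V by (auto simp: regular_down_def)
    \<comment> \<open>From \<open>e p'\<close> below \<open>e p\<close> one cannot conclude that
      \<open>p'\<close> is below \<open>p\<close>. Still every \<open>q\<close> below
      \<open>p'\<close> is compatible with \<open>p\<close>, so \<open>V\<close> is dense below
      \<open>p'\<close>.\<close>
    have "p' \<in> V" if p': "p' \<in> Field r" "(e p', e p) \<in> s" for p'
    proof -
      have "\<exists>w. (w, q) \<in> r \<and> w \<in> V" if q: "(q, p') \<in> r" for q
      proof -
        have "(e q, e p) \<in> s" using mono[OF q] p'(2) s(2) by (meson transD)
        then obtain v where "(v, q) \<in> r" "(v, p) \<in> r"
          using compat[of q p "e q"] FieldD[OF q] pF ss eF by blast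
        then show ?thesis using regular_down_closed[OF r(2) V p] by blast
      qed
      then show ?thesis using V p'(1) unfolding regular_down_def by blast
    qed
    then show "p \<in> G (F V)" using pF eF by (simp add: G_def F_def)
  qed
  have FG: "F (G U) = U" if U: "regular_down s U" for U
  proof (intro equalityI subsetI)
    fix q assume q: "q \<in> F (G U)"
    have "\<exists>w. (w, q') \<in> s \<and> w \<in> U" if q': "(q', q) \<in> s" for q'
    proof -
      obtain u where u: "u \<in> Field r" "(e u, q') \<in> s" using dense FieldD'[OF q'] by blast
      have "(e u, q) \<in> s" using u(2) q' s(2) by (meson transD)
      then have "e u \<in> U" using q u(1) by (auto simp: F_def G_def)
      then show ?thesis using u by blast
    qed
    moreover have "q \<in> Field s" using q by (simp add: F_def)
    ultimately show "q \<in> U" using U unfolding regular_down_def by blast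
  next
    fix q assume q: "q \<in> U"
    then have "q \<in> Field s" using U by (auto simp: regular_down_def)
    then show "q \<in> F (G U)"
      using regular_down_closed[OF s(2) U q] by (auto simp: F_def G_def)
  qed
  have monoF: "F V \<subseteq> F V'" if "V \<subseteq> V'" for V V'
    using that by (auto simp: F_def)
  have monoG: "G V \<subseteq> G V'" if "V \<subseteq> V'" for V V'
    using that by (auto simp: G_def)
  have Fields: "Field (ro r) = {V. regular_down r V}" "Field (ro s) = {U. regular_down s U}"
    by (auto simp: ro_eq_regular_down[OF r] ro_eq_regular_down[OF s] Field_relation_of)
  have "bij_betw F (Field (ro r)) (Field (ro s))"
    unfolding Fields by (rule bij_betw_byWitness[where f' = G]) (use GF FG regF regG in auto)
  moreover have "(V, V') \<in> ro r \<longleftrightarrow> (F V, F V') \<in> ro s"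
    if "V \<in> Field (ro r)" "V' \<in> Field (ro r)" for V V'
  proof -
    have V: "regular_down r V" "regular_down r V'" using that by (auto simp: Fields)
    have "F V \<subseteq> F V' \<Longrightarrow> V \<subseteq> V'" using monoG[of "F V" "F V'"] GF V by simp
    then have "V \<subseteq> V' \<longleftrightarrow> F V \<subseteq> F V'" using monoF by blast
    then show ?thesis
      using V regF by (simp add: ro_eq_regular_down[OF r] ro_eq_regular_down[OF s] relation_of_def)
  qed
  ultimately show ?thesis
    unfolding order_isomorphic_def by blast
qed

text \<open>The inclusion is a dense map: a member of \<open>F\<close> inside two members of
  \<open>D\<close> contains a member of \<open>D\<close>, which witnesses compatibility in
  \<open>D\<close>.\<close>

lemma ro_iso_of_dense_subfamily:
  assumes "D \<subseteq> F" "\<And>x. x \<in> F \<Longrightarrow> \<exists>d\<in>D. d \<subseteq> x"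
  shows "ro (relation_of (\<subseteq>) D) \<cong>\<^sub>o ro (relation_of (\<subseteq>) F)"
proof (rule ro_iso_of_dense_map[where e = "\<lambda>x. x"])
  fix p q t
  assume "p \<in> Field (relation_of (\<subseteq>) D)" "q \<in> Field (relation_of (\<subseteq>) D)"
    and t: "(t, p) \<in> relation_of (\<subseteq>) F" "(t, q) \<in> relation_of (\<subseteq>) F"
  then have "p \<in> D" "q \<in> D" by (simp_all add: Field_relation_of)
  moreover obtain d where "d \<in> D" "d \<subseteq> t"
    using assms(2)[of t] t by (auto simp: relation_of_def)
  ultimately have "(d, p) \<in> relation_of (\<subseteq>) D \<and> (d, q) \<in> relation_of (\<subseteq>) D"
    using t by (auto simp: relation_of_def)
  then show "\<exists>u. (u, p) \<in> relation_of (\<subseteq>) D \<and> (u, q) \<in> relation_of (\<subseteq>) D" ..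
next
  fix q assume "q \<in> Field (relation_of (\<subseteq>) F)"
  then have "q \<in> F" by (simp add: Field_relation_of)
  then obtain d where "d \<in> D" "d \<subseteq> q" using assms(2) by blast
  moreover have "(d, q) \<in> relation_of (\<subseteq>) F"
    using calculation assms(1) \<open>q \<in> F\<close> by (auto simp: relation_of_def)
  ultimately show "\<exists>p\<in>Field (relation_of (\<subseteq>) D). (p, q) \<in> relation_of (\<subseteq>) F"
    by (auto simp: Field_relation_of)
next
  show "(p, q) \<in> relation_of (\<subseteq>) F" if "(p, q) \<in> relation_of (\<subseteq>) D" for p q
    using that assms(1) by (auto simp: relation_of_def)
qed (simp_all add: refl_on_relation_of_subset trans_relation_of_subset)

lemma ro_iso_of_order_iso:
  assumes r: "refl_on (Field r) r" "trans r" and s: "refl_on (Field s) s" "trans s"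
    and "r \<cong>\<^sub>o s"
  shows "ro r \<cong>\<^sub>o ro s"
proof -
  obtain f where f: "bij_betw f (Field r) (Field s)"
    "\<And>p q. p \<in> Field r \<Longrightarrow> q \<in> Field r \<Longrightarrow> (p, q) \<in> r \<longleftrightarrow> (f p, f q) \<in> s"
    using assms(5) by (auto simp: order_isomorphic_def)
  have surj: "\<exists>p\<in>Field r. q = f p" if "q \<in> Field s" for q
    using f(1) that by (auto simp: bij_betw_def)
  show ?thesis
  proof (rule ro_iso_of_dense_map[OF r s])
    show "(f p, f q) \<in> s" if "(p, q) \<in> r" for p q
      using f(2) that by (metis FieldI1 FieldI2)
    show "\<exists>u. (u, p) \<in> r \<and> (u, q) \<in> r"
      if "p \<in> Field r" "q \<in> Field r" "(t, f p) \<in> s" "(t, f q) \<in> s" for p q t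
      using f(2) that surj by (metis FieldI1)
    show "\<exists>p\<in>Field r. (f p, q) \<in> s" if "q \<in> Field s" for q
      using surj[OF that] s(1) that by (metis refl_onD)
  qed
qed

section \<open>The separative quotient\<close>

lemma sep_le_refl: "refl_on (Field r) r \<Longrightarrow> p \<in> Field r \<Longrightarrow> (p, p) \<in> sep_le r"
  unfolding sep_le_def by (auto simp: refl_on_def Field_def)

lemma sep_le_of_le:
  assumes "refl_on (Field r) r" "trans r" "(p, q) \<in> r"
  shows "(p, q) \<in> sep_le r"
proof -
  have "\<exists>t. (t, s) \<in> r \<and> (t, q) \<in> r" if "(s, p) \<in> r" for s
    using that assms by (metis FieldI1 refl_onD transD)
  then show ?thesis using assms(3) by (auto simp: sep_le_def Field_def)
qed

lemma trans_sep_le: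
  assumes "trans r" shows "trans (sep_le r)"
proof (rule transI)
  fix p q w assume pq: "(p, q) \<in> sep_le r" and qw: "(q, w) \<in> sep_le r"
  have "\<exists>t. (t, s) \<in> r \<and> (t, w) \<in> r" if s: "(s, p) \<in> r" for s
  proof -
    obtain t where t: "(t, s) \<in> r" "(t, q) \<in> r" using pq s by (auto simp: sep_le_def)
    obtain u where "(u, t) \<in> r" "(u, w) \<in> r" using qw t by (auto simp: sep_le_def)
    then show ?thesis using t assms by (meson transD)
  qed
  then show "(p, w) \<in> sep_le r" using pq qw by (auto simp: sep_le_def)
qed

lemma sep_le_subset: "sep_le r \<subseteq> Field r \<times> Field r"
  by (auto simp: sep_le_def)

text \<open>Transitivity of \<open>sep_le\<close> makes the order on classes independent of the
  representatives through which \<open>sq\<close> defines it.\<close>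

lemma mem_sq_iff:
  assumes "refl_on (Field r) r" "trans r" "p \<in> Field r" "q \<in> Field r"
  shows "(sep_eq r `` {p}, sep_eq r `` {q}) \<in> sq r \<longleftrightarrow> (p, q) \<in> sep_le r"
proof
  assume "(sep_eq r `` {p}, sep_eq r `` {q}) \<in> sq r"
  then obtain p' q' where *: "sep_eq r `` {p} = sep_eq r `` {p'}" "sep_eq r `` {q} = sep_eq r `` {q'}"
    "(p', q') \<in> sep_le r"
    unfolding sq_def by blast
  have "p \<in> sep_eq r `` {p}" "q \<in> sep_eq r `` {q}"
    using assms by (auto simp: sep_eq_def sep_le_refl)
  then have "p \<in> sep_eq r `` {p'}" "q \<in> sep_eq r `` {q'}"
    using * by auto
  then show "(p, q) \<in> sep_le r"
    using *(3) trans_sep_le[OF assms(2)] by (auto simp: sep_eq_def dest: transD)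
qed (auto simp: sq_def)

lemma Field_sq:
  assumes "refl_on (Field r) r"
  shows "Field (sq r) = (\<lambda>p. sep_eq r `` {p}) ` Field r"
proof
  show "Field (sq r) \<subseteq> (\<lambda>p. sep_eq r `` {p}) ` Field r"
    using sep_le_subset[of r] by (auto simp: sq_def Field_def)
  show "(\<lambda>p. sep_eq r `` {p}) ` Field r \<subseteq> Field (sq r)"
  proof (rule image_subsetI)
    fix p assume "p \<in> Field r"
    then have "(sep_eq r `` {p}, sep_eq r `` {p}) \<in> sq r"
      using sep_le_refl[OF assms] by (auto simp: sq_def)
    then show "sep_eq r `` {p} \<in> Field (sq r)" by (rule FieldI1)
  qed
qed

text \<open>The quotient map is onto, hence dense. It preserves incompatibility: a representative
  \<open>w\<close> of a class below those of \<open>p\<close> and \<open>q\<close> is shrunk by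
  \<open>sep_le\<close> first to a point below \<open>p\<close>, then to one below \<open>q\<close>
  as well.\<close>

lemma ro_sq_iso:
  assumes r: "refl_on (Field r) r" "trans r"
  shows "ro r \<cong>\<^sub>o ro (sq r)"
proof (rule ro_iso_of_dense_map[OF r, where e = "\<lambda>p. sep_eq r `` {p}"])
  show "refl_on (Field (sq r)) (sq r)"
    by (auto simp: refl_on_def Field_sq[OF r(1)] mem_sq_iff[OF r] sep_le_refl[OF r(1)])
  show "trans (sq r)"
  proof (rule transI)
    fix x y z assume xy: "(x, y) \<in> sq r" and yz: "(y, z) \<in> sq r"
    then have "x \<in> Field (sq r)" "y \<in> Field (sq r)" "z \<in> Field (sq r)" by (auto simp: Field_def)
    with xy yz show "(x, z) \<in> sq r"
      using trans_sep_le[OF r(2)]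
      by (auto simp: Field_sq[OF r(1)] mem_sq_iff[OF r] dest: transD)
  qed
  show "(sep_eq r `` {p}, sep_eq r `` {q}) \<in> sq r" if "(p, q) \<in> r" for p q
    using that sep_le_of_le[OF r that] by (auto simp: sq_def)
  show "\<exists>u. (u, p) \<in> r \<and> (u, q) \<in> r"
    if pq: "p \<in> Field r" "q \<in> Field r" and
      t: "(t, sep_eq r `` {p}) \<in> sq r" "(t, sep_eq r `` {q}) \<in> sq r" for p q t
  proof -
    have "t \<in> Field (sq r)" using t by (auto simp: Field_def)
    then obtain w where w: "w \<in> Field r" "t = sep_eq r `` {w}" by (auto simp: Field_sq[OF r(1)])
    then have "(w, p) \<in> sep_le r" "(w, q) \<in> sep_le r"
      using t pq mem_sq_iff[OF r] by auto
    moreover have "(w, w) \<in> r" using r(1) w(1) by (simp add: refl_onD)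
    ultimately obtain u where u: "(u, w) \<in> r" "(u, p) \<in> r" by (auto simp: sep_le_def)
    then obtain v where "(v, u) \<in> r" "(v, q) \<in> r"
      using \<open>(w, q) \<in> sep_le r\<close> by (auto simp: sep_le_def)
    then show ?thesis using u r(2) by (meson transD)
  qed
  show "\<exists>p\<in>Field r. (sep_eq r `` {p}, q) \<in> sq r" if "q \<in> Field (sq r)" for q
    using that sep_le_refl[OF r(1)] unfolding Field_sq[OF r(1)] by (blast intro: mem_sq_iff[OF r, THEN iffD2])
qed

section \<open>Cantor schemes and perfect sets\<close>

definition lex_less :: "(nat \<Rightarrow> bool) \<Rightarrow> (nat \<Rightarrow> bool) \<Rightarrow> bool" where
  "lex_less b c \<longleftrightarrow> (\<exists>n. (\<forall>i<n. b i = c i) \<and> \<not> b n \<and> c n)"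

lemma lex_less_linear:
  assumes "b \<noteq> c" shows "lex_less b c \<or> lex_less c b"
proof -
  define n where "n = (LEAST i. b i \<noteq> c i)"
  have "\<exists>i. b i \<noteq> c i" using assms by auto
  then have "b n \<noteq> c n" unfolding n_def by (rule LeastI_ex)
  moreover have "\<forall>i<n. b i = c i" unfolding n_def using not_less_Least by blast
  ultimately show ?thesis unfolding lex_less_def by metis
qed

text \<open>Monotonicity, rather than mere injectivity, is demanded because composing such a map
  with an order embedding of the reals into the Cantor space must again give an order
  embedding.\<close>

definition cantor_map :: "((nat \<Rightarrow> bool) \<Rightarrow> real) \<Rightarrow> bool" where
  "cantor_map k \<longleftrightarrow> continuous_on UNIV k \<and> (\<forall>b c. lex_less b c \<longrightarrow> k b < k c)"

lemma cantor_map_inj: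
  assumes "cantor_map k" shows "inj k"
proof (rule injI, rule ccontr)
  fix b c assume "k b = k c" "b \<noteq> c"
  then show False
    using lex_less_linear[OF \<open>b \<noteq> c\<close>] assms unfolding cantor_map_def by (metis less_irrefl)
qed

lemma open_agree: "open {c::nat \<Rightarrow> bool. \<forall>i<n. c i = b i}"
proof -
  have "open {c. \<forall>i\<in>{..<n}. c (id i) \<in> {b i}}"
    by (rule product_topology_basis') (auto simp: open_discrete)
  moreover have "{c. \<forall>i\<in>{..<n}. c (id i) \<in> {b i}} = {c. \<forall>i<n. c i = b i}" by auto
  ultimately show ?thesis by simp
qed

text \<open>A binary tree of closed balls centred in \<open>C\<close> is built with radii at least
  halved at each level, such that \<open>h\<close> is smaller on the left child than on the right
  one. Completeness gives every branch a limit in \<open>C\<close>. The map \<open>h\<close> is the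
  identity for perfect sets and a projection for Borel sets.\<close>

lemma cantor_scheme:
  fixes C :: "'a::complete_space set" and h :: "'a \<Rightarrow> real"
  assumes "closed C" "C \<noteq> {}" and h: "continuous_on UNIV h"
    and split: "\<And>U. open U \<Longrightarrow> C \<inter> U \<noteq> {} \<Longrightarrow> \<exists>y\<in>C \<inter> U. \<exists>z\<in>C \<inter> U. h y \<noteq> h z"
  shows "\<exists>k. cantor_map k \<and> range k \<subseteq> h ` C"
proof -
  \<comment> \<open>Nodes of the tree are pairs of a centre and a radius. In \<open>good\<close>,
    the children are indexed by \<open>bool\<close> and \<open>False\<close> is the left
    one.\<close>
  define ok where "ok p \<longleftrightarrow> fst p \<in> C \<and> 0 < snd p" for p :: "'a \<times> real"
  define B where "B p = cball (fst p) (snd p)" for p :: "'a \<times> real"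
  define good where "good p q \<longleftrightarrow>
      (\<forall>i. ok (q i) \<and> snd (q i) \<le> snd p / 2 \<and> B (q i) \<subseteq> B p) \<and>
      (\<forall>u\<in>B (q False). \<forall>v\<in>B (q True). h u < h v)" for p and q :: "bool \<Rightarrow> 'a \<times> real"
  have shrink: "\<exists>d>0. d \<le> snd p / 2 \<and> cball y d \<subseteq> B p \<and> (\<forall>u\<in>cball y d. h u \<in> V)"
    if "0 < snd p" "y \<in> ball (fst p) (snd p)" "open V" "h y \<in> V" for p y V
  proof -
    have "open (ball (fst p) (snd p) \<inter> h -` V)" (is "open ?W")
      using that h by (intro open_Int open_ball) (auto simp: open_vimage)
    then have "\<forall>x\<in>?W. \<exists>d>0. cball x d \<subseteq> ?W"
      by (simp only: open_contains_cball)
    moreover have "y \<in> ?W" using that by simp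
    ultimately obtain d where d: "d > 0" "cball y d \<subseteq> ball (fst p) (snd p) \<inter> h -` V"
      by blast
    have "cball y (min d (snd p / 2)) \<subseteq> cball y d" by auto
    with d(2) have "cball y (min d (snd p / 2)) \<subseteq> ball (fst p) (snd p) \<inter> h -` V" by blast
    then have "cball y (min d (snd p / 2)) \<subseteq> B p" "\<forall>u\<in>cball y (min d (snd p / 2)). h u \<in> V"
      unfolding B_def using ball_subset_cball by blast+
    then show ?thesis using d that by (intro exI[of _ "min d (snd p / 2)"]) auto
  qed
  have "\<exists>q. good p q" if p: "ok p" for p
  proof -
    have "C \<inter> ball (fst p) (snd p) \<noteq> {}"
      using p by (auto simp: ok_def)
    then obtain y z where yz: "y \<in> C" "z \<in> C" "y \<in> ball (fst p) (snd p)" "z \<in> ball (fst p) (snd p)"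
      "h y < h z"
      using split[OF open_ball, of "fst p" "snd p"] by (metis IntE linorder_neqE)
    \<comment> \<open>By continuity \<open>h\<close> stays below the midpoint near \<open>y\<close>
      and above it near \<open>z\<close>, which separates the two children.\<close>
    define m where "m = (h y + h z) / 2"
    have m: "h y < m" "m < h z" using yz by (auto simp: m_def)
    have pos: "0 < snd p" using p by (simp add: ok_def)
    obtain d where d: "d > 0" "d \<le> snd p / 2" "cball y d \<subseteq> B p" "\<forall>u\<in>cball y d. h u \<in> {..<m}"
      using shrink[OF pos yz(3), of "{..<m}"] m by auto
    obtain e where e: "e > 0" "e \<le> snd p / 2" "cball z e \<subseteq> B p" "\<forall>u\<in>cball z e. h u \<in> {m<..}"
      using shrink[OF pos yz(4), of "{m<..}"] m by auto
    have "good p (\<lambda>i. if i then (z, e) else (y, d))"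
      using d e yz unfolding good_def ok_def B_def[of "(_, _)"]
      by (force simp: B_def[of "(_, _)"])
    then show ?thesis by blast
  qed
  then obtain S where S: "\<And>p. ok p \<Longrightarrow> good p (S p)" by metis
  obtain x0 where x0: "x0 \<in> C" using assms(2) by blast
  \<comment> \<open>The step from level \<open>n\<close> follows the child \<open>b n\<close>, so
    \<open>node b n\<close> reads only the values of \<open>b\<close> before \<open>n\<close>. This
    gives \<open>agree\<close> and thereby continuity of the limit map. The initial radius 1 leads
    to the bound \<open>(1/2) ^ n\<close>.\<close>
  define node where "node b = rec_nat (x0, 1) (\<lambda>n p. S p (b n))" for b :: "nat \<Rightarrow> bool"
  have node0: "node b 0 = (x0, 1)" and nodeS: "node b (Suc n) = S (node b n) (b n)" for b n
    by (simp_all add: node_def)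
  have ok: "ok (node b n)" for b n
    by (induction n) (use S x0 in \<open>auto simp: node0 nodeS ok_def[of "(_, _)"] good_def\<close>)
  have sub1: "B (node b (Suc n)) \<subseteq> B (node b n)" and rad1: "snd (node b (Suc n)) \<le> snd (node b n) / 2" for b n
    using S[OF ok[of b n]] by (auto simp: nodeS good_def)
  have sub: "B (node b m) \<subseteq> B (node b n)" if "n \<le> m" for b n m
    using sub1 that by (rule lift_Suc_antimono_le)
  have rad: "snd (node b n) \<le> (1/2) ^ n" for b n
  proof (induction n)
    case (Suc n)
    then show ?case using rad1[of b n] by simp
  qed (simp add: node0)
  have mem: "fst (node b m) \<in> B (node b n)" if "n \<le> m" for b n m
  proof -
    have "fst (node b m) \<in> B (node b m)" using ok[of b m] by (simp add: B_def ok_def)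
    then show ?thesis using sub[OF that] by blast
  qed
  have dist_le: "dist u v \<le> 2 * (1/2) ^ n" if "u \<in> B (node b n)" "v \<in> B (node b n)" for u v b n
  proof -
    have "dist (fst (node b n)) u \<le> snd (node b n)" "dist (fst (node b n)) v \<le> snd (node b n)"
      using that by (auto simp: B_def)
    then show ?thesis using dist_triangle3[of u v "fst (node b n)"] rad[of b n] by linarith
  qed
  have small: "\<exists>n. 2 * (1/2) ^ n < e" if e: "e > 0" for e :: real
  proof -
    obtain n where "(1/2::real) ^ n < e / 2"
      using real_arch_pow_inv[of "e / 2" "1 / 2"] e by auto
    then show ?thesis by (intro exI[of _ n]) simp
  qed
  have "convergent (\<lambda>n. fst (node b n))" for b
    unfolding Cauchy_convergent_iff[symmetric]
  proof (rule metric_CauchyI)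
    fix e :: real assume "e > 0"
    then obtain n where n: "2 * (1/2) ^ n < e" using small by blast
    have "dist (fst (node b i)) (fst (node b j)) < e" if "n \<le> i" "n \<le> j" for i j
      using dist_le[OF mem[OF that(1), of b] mem[OF that(2)]] n by simp
    then show "\<exists>M. \<forall>m\<ge>M. \<forall>n\<ge>M. dist (fst (node b m)) (fst (node b n)) < e" by blast
  qed
  then have "\<exists>l. (\<lambda>n. fst (node b n)) \<longlonglongrightarrow> l" for b
    by (simp add: convergent_def)
  then obtain g where g: "\<And>b. (\<lambda>n. fst (node b n)) \<longlonglongrightarrow> g b" by metis
  have gC: "g b \<in> C" for b
    using ok by (intro closed_sequentially[OF assms(1) _ g]) (auto simp: ok_def)
  have gB: "g b \<in> B (node b n)" for b n
  proof (rule Lim_in_closed_set[OF _ _ _ g])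
    show "closed (B (node b n))" by (simp add: B_def)
    show "\<forall>\<^sub>F m in sequentially. fst (node b m) \<in> B (node b n)"
      using mem unfolding eventually_sequentially by blast
  qed simp
  have agree: "node b n = node c n" if "\<forall>i<n. b i = c i" for b c n
    using that by (induction n) (auto simp: node0 nodeS)
  have "continuous_on UNIV g"
    unfolding continuous_on_topological
  proof (intro ballI allI impI)
    fix b V assume "open V" "g b \<in> V"
    then obtain e where e: "e > 0" "ball (g b) e \<subseteq> V" by (meson open_contains_ball)
    then obtain n where n: "2 * (1/2) ^ n < e" using small by blast
    have "g c \<in> V" if "\<forall>i<n. c i = b i" for c
    proof -
      have "g c \<in> B (node b n)" using gB[of c n] agree[OF that] by simp
      then have "dist (g b) (g c) < e" using dist_le[OF gB] n by (meson le_less_trans)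
      then show ?thesis using e by auto
    qed
    then show "\<exists>A. open A \<and> b \<in> A \<and> (\<forall>c\<in>UNIV. c \<in> A \<longrightarrow> g c \<in> V)"
      using open_agree[of n b] by (intro exI[of _ "{c. \<forall>i<n. c i = b i}"]) auto
  qed
  then have "continuous_on UNIV (h \<circ> g)"
    using h by (meson continuous_on_compose continuous_on_subset subset_UNIV)
  moreover have "h (g b) < h (g c)" if "lex_less b c" for b c
  proof -
    obtain n where n: "\<forall>i<n. b i = c i" "\<not> b n" "c n" using \<open>lex_less b c\<close> by (auto simp: lex_less_def)
    have "g b \<in> B (S (node b n) False)" "g c \<in> B (S (node b n) True)"
      using gB[of b "Suc n"] gB[of c "Suc n"] n agree[OF n(1)] by (auto simp: nodeS)
    then show ?thesis using S[OF ok[of b n]] by (auto simp: good_def)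
  qed
  ultimately have "cantor_map (h \<circ> g)" by (simp add: cantor_map_def)
  then show ?thesis using gC by (intro exI[of _ "h \<circ> g"]) auto
qed

text \<open>With the identity for \<open>h\<close>, the splitting hypothesis of the scheme is the
  absence of isolated points.\<close>

lemma perfect_contains_cantor:
  fixes P :: "real set"
  assumes "perfect P"
  shows "\<exists>k. cantor_map k \<and> range k \<subseteq> P"
proof -
  have "\<exists>y\<in>P \<inter> U. \<exists>z\<in>P \<inter> U. y \<noteq> z" if U: "open U" "P \<inter> U \<noteq> {}" for U
  proof -
    obtain x where x: "x \<in> P" "x \<in> U" using U by blast
    then have "x islimpt P" using assms by (simp add: perfect_def)
    then obtain y where "y \<in> P" "y \<in> U" "y \<noteq> x" using U x by (meson islimpt_def)
    then show ?thesis using x by blast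
  qed
  then show ?thesis
    using cantor_scheme[of P "\<lambda>x. x"] assms by (auto simp: perfect_def)
qed

text \<open>The lower Dedekind cut of \<open>x\<close>, read as a binary sequence along an
  enumeration of the rationals.\<close>

definition rational_cut :: "real \<Rightarrow> nat \<Rightarrow> bool" where
  "rational_cut x n \<longleftrightarrow> of_rat (from_nat_into UNIV n) < x"

text \<open>The cut of \<open>x\<close> is contained in that of \<open>y\<close>, and a rational in
  between makes them differ; hence at the first difference only the cut of \<open>y\<close> has the
  value \<open>True\<close>.\<close>

lemma lex_less_rational_cut:
  assumes "x < y" shows "lex_less (rational_cut x) (rational_cut y)"
proof -
  obtain q where "x < of_rat q" "of_rat q < y" using of_rat_dense[OF assms] by blast
  moreover obtain n where "q = from_nat_into UNIV n"
    using from_nat_into_surj[of "UNIV :: rat set" q] by auto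
  ultimately have "rational_cut x n \<noteq> rational_cut y n" by (auto simp: rational_cut_def)
  then have "rational_cut x \<noteq> rational_cut y" by metis
  moreover have "\<not> lex_less (rational_cut y) (rational_cut x)"
    using assms by (auto simp: lex_less_def rational_cut_def)
  ultimately show ?thesis using lex_less_linear by blast
qed

lemma uncountable_binary_sequences: "uncountable (UNIV :: (nat \<Rightarrow> bool) set)"
proof
  assume "countable (UNIV :: (nat \<Rightarrow> bool) set)"
  then have "countable (range rational_cut)" by (rule countable_subset[OF subset_UNIV])
  moreover have "inj rational_cut"
    by (rule injI) (metis lex_less_def lex_less_rational_cut linorder_neqE)
  ultimately show False
    using countable_image_inj_on uncountable_UNIV_real by blast
qed

lemma perfect_uncountable:
  fixes P :: "real set"
  assumes "perfect P" shows "uncountable P"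
proof -
  obtain k where k: "cantor_map k" "range k \<subseteq> P" using perfect_contains_cantor[OF assms] by blast
  then have "uncountable (range k)"
    using cantor_map_inj uncountable_binary_sequences countable_image_inj_on by blast
  then show ?thesis using k countable_subset by blast
qed

section \<open>Topology of the Cantor space and of its images\<close>

lemma compact_binary_sequences: "compact (UNIV :: (nat \<Rightarrow> bool) set)"
proof -
  have "compact (UNIV :: bool set)" by (simp add: finite_imp_compact)
  then have "compact_space (euclidean :: bool topology)"
    by (simp add: compact_space_def)
  then have "compact_space (product_topology (\<lambda>_::nat. euclidean :: bool topology) UNIV)"
    by (simp add: compact_space_product_topology)
  then show ?thesis by (simp add: euclidean_product_topology compact_space_def)
qed

text \<open>A basic open set restricts only finitely many coordinates, so flipping an unrestricted
  one yields a different point of it.\<close>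

lemma perfect_binary_sequences: "perfect (UNIV :: (nat \<Rightarrow> bool) set)"
  unfolding perfect_def
proof (intro conjI ballI)
  fix b :: "nat \<Rightarrow> bool"
  show "b islimpt UNIV"
  proof (rule islimptI)
    fix T assume T: "b \<in> T" "open T"
    then obtain X where X: "b \<in> (\<Pi>\<^sub>E i\<in>UNIV. X i)" "finite {i. X i \<noteq> UNIV}" "(\<Pi>\<^sub>E i\<in>UNIV. X i) \<subseteq> T"
      using product_topology_open_contains_basis[of "\<lambda>_. euclidean" UNIV T b]
      by (auto simp: open_fun_def)
    obtain n where "X n = UNIV"
      using X(2) infinite_UNIV_nat by (metis (mono_tags, lifting) UNIV_eq_I mem_Collect_eq)
    then have "b(n := \<not> b n) \<in> (\<Pi>\<^sub>E i\<in>UNIV. X i)"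
      using X(1) by (auto simp: PiE_iff)
    then have "b(n := \<not> b n) \<in> T" using X(3) by blast
    moreover have "b(n := \<not> b n) \<noteq> b" by (metis fun_upd_same)
    ultimately show "\<exists>y\<in>UNIV. y \<in> T \<and> y \<noteq> b" by blast
  qed
qed auto

text \<open>Compactness makes the image closed; injectivity keeps the images of nearby distinct
  points distinct, so no image point is isolated.\<close>

lemma perfect_image:
  fixes T :: "'a::topological_space set" and h :: "'a::topological_space \<Rightarrow> 'b::t2_space"
  assumes "perfect T" "compact T" "continuous_on T h" "inj_on h T"
  shows "perfect (h ` T)"
  unfolding perfect_def
proof (intro conjI ballI)
  show "h ` T \<noteq> {}" using assms by (simp add: perfect_def)
  show "closed (h ` T)" using assms by (simp add: compact_continuous_image compact_imp_closed)
  fix y assume "y \<in> h ` T"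
  then obtain x where x: "x \<in> T" "y = h x" by blast
  show "y islimpt h ` T"
  proof (rule islimptI)
    fix V assume V: "y \<in> V" "open V"
    then obtain A where A: "open A" "x \<in> A" "\<forall>u\<in>T. u \<in> A \<longrightarrow> h u \<in> V"
      using assms(3) x unfolding continuous_on_topological by blast
    moreover have "x islimpt T" using assms(1) x by (simp add: perfect_def)
    ultimately obtain u where "u \<in> T" "u \<in> A" "u \<noteq> x" by (meson islimpt_def)
    then show "\<exists>y'\<in>h ` T. y' \<in> V \<and> y' \<noteq> y"
      using A x assms(4) by (auto simp: inj_on_def)
  qed
qed

lemma cantor_map_range:
  assumes "cantor_map k"
  shows "perfect (range k)" "compact (range k)"
proof -
  have k: "continuous_on UNIV k" "inj_on k UNIV"
    using assms cantor_map_inj by (auto simp: cantor_map_def)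
  show "perfect (range k)"
    by (rule perfect_image[OF perfect_binary_sequences compact_binary_sequences k])
  show "compact (range k)"
    by (rule compact_continuous_image[OF k(1) compact_binary_sequences])
qed

text \<open>Interleaving splits the Cantor space into continuum many disjoint copies of itself.\<close>

definition interleave :: "(nat \<Rightarrow> bool) \<Rightarrow> (nat \<Rightarrow> bool) \<Rightarrow> nat \<Rightarrow> bool" where
  "interleave x b n = (if even n then x (n div 2) else b (n div 2))"

lemma interleave_inj: "interleave x b = interleave y c \<Longrightarrow> x = y \<and> b = c"
proof -
  assume *: "interleave x b = interleave y c"
  have "x n = y n" "b n = c n" for n
    using fun_cong[OF *, of "2 * n"] fun_cong[OF *, of "2 * n + 1"] by (auto simp: interleave_def)
  then show ?thesis by auto
qed

text \<open>The even positions carry the fixed \<open>x\<close>, so a first difference of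
  \<open>b\<close> and \<open>c\<close> at \<open>n\<close> becomes a first difference at the odd
  position \<open>2 * n + 1\<close>, with the same orientation.\<close>

lemma cantor_map_interleave:
  assumes "cantor_map k" shows "cantor_map (\<lambda>b. k (interleave x b))"
  unfolding cantor_map_def
proof (intro conjI allI impI)
  have "continuous_on UNIV (interleave x)"
  proof (rule continuous_on_coordinatewise_then_product)
    show "continuous_on UNIV (\<lambda>b. interleave x b n)" for n
      by (cases "even n") (simp_all add: interleave_def)
  qed
  then show "continuous_on UNIV (\<lambda>b. k (interleave x b))"
    using assms by (metis UNIV_I cantor_map_def continuous_on_compose2 subsetI)
  fix b c assume "lex_less b c"
  then obtain n where n: "\<forall>i<n. b i = c i" "\<not> b n" "c n" by (auto simp: lex_less_def)
  have "interleave x b i = interleave x c i" if "i < 2 * n + 1" for i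
    using n(1) that by (auto simp: interleave_def elim!: oddE)
  then have "lex_less (interleave x b) (interleave x c)"
    unfolding lex_less_def using n(2,3)
    by (intro exI[of _ "2 * n + 1"]) (simp add: interleave_def[of _ _ "Suc (2 * n)"])
  then show "k (interleave x b) < k (interleave x c)" using assms by (simp add: cantor_map_def)
qed

text \<open>The interleavings give uncountably many disjoint Cantor subsets, and a countable set
  cannot meet all of them.\<close>

lemma cantor_avoid_countable:
  assumes k: "cantor_map k" and "countable D"
  shows "\<exists>k'. cantor_map k' \<and> range k' \<subseteq> range k - D"
proof -
  let ?K = "\<lambda>x. range (\<lambda>b. k (interleave x b))"
  have "\<exists>x. ?K x \<inter> D = {}"
  proof (rule ccontr)
    assume "\<nexists>x. ?K x \<inter> D = {}"
    then have "\<forall>x. \<exists>b. k (interleave x b) \<in> D" by blast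
    then obtain f where f: "\<And>x. k (interleave x (f x)) \<in> D" by metis
    have "inj (\<lambda>x. k (interleave x (f x)))"
      using cantor_map_inj[OF k] by (auto intro!: injI dest!: injD interleave_inj)
    moreover have "countable (range (\<lambda>x. k (interleave x (f x))))"
      by (rule countable_subset[OF _ assms(2)]) (use f in auto)
    ultimately show False using countable_image_inj_on uncountable_binary_sequences by blast
  qed
  then obtain x where "?K x \<inter> D = {}" by blast
  then show ?thesis using cantor_map_interleave[OF k, of x] by (intro exI[of _ "\<lambda>b. k (interleave x b)"]) auto
qed

text \<open>A monotone function has only countably many discontinuities. On a Cantor set that avoids
  them, composing with \<open>f\<close> keeps both continuity and monotonicity.\<close>

lemma perfect_strict_mono_image:
  fixes f :: "real \<Rightarrow> real"
  assumes "perfect P" "strict_mono_on P f"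
  shows "\<exists>k. cantor_map k \<and> range k \<subseteq> f ` P"
proof -
  obtain k where k: "cantor_map k" "range k \<subseteq> P" using perfect_contains_cantor[OF assms(1)] by blast
  let ?D = "{a \<in> P. \<not> continuous (at a within P) f}"
  have "countable ?D"
    by (rule mono_on_ctble_discont) (rule strict_mono_on_imp_mono_on[OF assms(2)])
  then obtain k' where k': "cantor_map k'" "range k' \<subseteq> range k - ?D"
    using cantor_avoid_countable[OF k(1)] by blast
  then have sub: "range k' \<subseteq> P - ?D" using k by blast
  then have "continuous_on (range k') f"
    unfolding continuous_on_eq_continuous_within
    by (blast intro: continuous_within_subset)
  then have "continuous_on UNIV (f \<circ> k')"
    using k'(1) continuous_on_compose by (auto simp: cantor_map_def)
  moreover have "\<forall>b c. lex_less b c \<longrightarrow> (f \<circ> k') b < (f \<circ> k') c"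
    using k'(1) sub strict_mono_onD[OF assms(2)] by (auto simp: cantor_map_def image_subset_iff)
  ultimately have "cantor_map (f \<circ> k')" by (simp add: cantor_map_def)
  then show ?thesis using sub by (intro exI[of _ "f \<circ> k'"]) auto
qed

section \<open>The perfect set theorem for Borel sets\<close>

text \<open>
  The sequence coordinate ranges over \<open>nat \<Rightarrow> real\<close> instead of the Baire space, since
  the Cantor scheme needs a complete metric; natural numbers are coded by integral reals.
\<close>

definition analytic_set :: "'a::topological_space set \<Rightarrow> bool" where
  "analytic_set A \<longleftrightarrow> (\<exists>C :: ('a \<times> (nat \<Rightarrow> real)) set. closed C \<and> A = fst ` C)"

lemma analytic_set_closed: "closed A \<Longrightarrow> analytic_set A"
  unfolding analytic_set_def by (intro exI[of _ "A \<times> UNIV"]) (auto intro: closed_Times)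

lemma continuous_on_snd_coordinate:
  "continuous_on UNIV (\<lambda>p :: 'a::topological_space \<times> ('b \<Rightarrow> 'c::topological_space). snd p i)"
  by (rule continuous_on_product_then_coordinatewise[OF continuous_on_snd[OF continuous_on_id]])

text \<open>Coordinate 0 of the new witness stores the index as an integer and the shifted sequence
  is the old witness. The union of the levels is closed because they are spaced apart: the open
  strip of width 2 around an integer meets only the level of that integer.\<close>

lemma analytic_set_UN:
  fixes A :: "nat \<Rightarrow> 'a::topological_space set"
  assumes "\<And>n. analytic_set (A n)"
  shows "analytic_set (\<Union>n. A n)"
proof -
  obtain C :: "nat \<Rightarrow> ('a \<times> (nat \<Rightarrow> real)) set"
    where C: "\<And>n. closed (C n)" "\<And>n. A n = fst ` C n"
    using assms unfolding analytic_set_def by metis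
  \<comment> \<open>For negative \<open>m\<close>, \<open>nat m\<close> is 0, so these extra levels
    project into \<open>A 0\<close> and do not enlarge the union.\<close>
  define E where "E m = {p :: 'a \<times> (nat \<Rightarrow> real). snd p 0 = of_int m} \<inter>
      (\<lambda>p. (fst p, \<lambda>i. snd p (Suc i))) -` C (nat m)" for m :: int
  define D where "D = (\<Union>m. E m)"
  have cont: "continuous_on UNIV (\<lambda>p :: 'a \<times> (nat \<Rightarrow> real). snd p 0)"
    by (rule continuous_on_snd_coordinate)
  have "closed (E m)" for m
    unfolding E_def
  proof (intro closed_Int closed_vimage C(1))
    show "closed {p :: 'a \<times> (nat \<Rightarrow> real). snd p 0 = of_int m}"
      by (rule closed_Collect_eq[OF cont continuous_on_const])
    show "continuous_on UNIV (\<lambda>p :: 'a \<times> (nat \<Rightarrow> real). (fst p, \<lambda>i. snd p (Suc i)))"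
      by (intro continuous_on_Pair continuous_on_coordinatewise_then_product
          continuous_on_snd_coordinate continuous_on_fst continuous_on_id)
  qed
  moreover have "open {p :: 'a \<times> (nat \<Rightarrow> real). snd p 0 \<in> {of_int m - 1<..<of_int m + 1}}" for m :: int
    using open_vimage[OF open_greaterThanLessThan cont] by (simp add: vimage_def)
  moreover have "- D = (\<Union>m. {p. snd p 0 \<in> {of_int m - 1<..<of_int m + 1}} \<inter> - E m)"
  proof (intro equalityI subsetI)
    fix p assume "p \<in> - D"
    then have "p \<in> {p. snd p 0 \<in> {of_int \<lfloor>snd p 0\<rfloor> - 1<..<of_int \<lfloor>snd p 0\<rfloor> + 1}} \<inter> - E \<lfloor>snd p 0\<rfloor>"
      unfolding D_def by (simp; linarith)
    then show "p \<in> (\<Union>m. {p. snd p 0 \<in> {of_int m - 1<..<of_int m + 1}} \<inter> - E m)" by blast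
  next
    fix p assume "p \<in> (\<Union>m. {p. snd p 0 \<in> {of_int m - 1<..<of_int m + 1}} \<inter> - E m)"
    then obtain m where m: "of_int m - 1 < snd p 0" "snd p 0 < of_int m + 1" "p \<notin> E m" by auto
    have "p \<notin> E n" for n
    proof
      assume "p \<in> E n"
      then have "snd p 0 = of_int n" by (simp add: E_def)
      then have "n = m" using m by linarith
      with \<open>p \<in> E n\<close> m show False by simp
    qed
    then show "p \<in> - D" by (simp add: D_def)
  qed
  ultimately have "open (- D)" by (simp add: open_UN open_Int open_Compl)
  moreover have "fst ` D = (\<Union>n. A n)"
  proof (intro equalityI subsetI)
    fix x assume "x \<in> (\<Union>n. A n)"
    then obtain n z where "(x, z) \<in> C n" using C(2) by auto
    then have "(x, case_nat (real n) z) \<in> E (int n)" by (simp add: E_def)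
    then have "(x, case_nat (real n) z) \<in> D" by (auto simp: D_def)
    then show "x \<in> fst ` D" by force
  qed (use C(2) in \<open>force simp: D_def E_def\<close>)
  ultimately show ?thesis
    unfolding analytic_set_def by (intro exI[of _ D]) (auto simp: closed_def)
qed

text \<open>One sequence holds a witness for every \<open>A n\<close> at once, its entries arranged
  by \<open>prod_encode\<close>; each condition on it is closed.\<close>

lemma analytic_set_INT:
  fixes A :: "nat \<Rightarrow> 'a::topological_space set"
  assumes "\<And>n. analytic_set (A n)"
  shows "analytic_set (\<Inter>n. A n)"
proof -
  obtain C :: "nat \<Rightarrow> ('a \<times> (nat \<Rightarrow> real)) set"
    where C: "\<And>n. closed (C n)" "\<And>n. A n = fst ` C n"
    using assms unfolding analytic_set_def by metis
  define D where "D = (\<Inter>n. (\<lambda>p. (fst p, \<lambda>i. snd p (prod_encode (n, i)))) -` C n)"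
  have "continuous_on UNIV (\<lambda>p :: 'a \<times> (nat \<Rightarrow> real). (fst p, \<lambda>i. snd p (prod_encode (n, i))))" for n
    by (intro continuous_on_Pair continuous_on_coordinatewise_then_product
          continuous_on_snd_coordinate continuous_on_fst continuous_on_id)
  then have "closed D"
    unfolding D_def using C(1) by (intro closed_INT ballI closed_vimage)
  moreover have "fst ` D = (\<Inter>n. A n)"
  proof (intro equalityI subsetI)
    fix x assume x: "x \<in> (\<Inter>n. A n)"
    have "\<exists>z. (x, z) \<in> C n" for n using x C(2)[of n] by force
    then obtain z where z: "\<And>n. (x, z n) \<in> C n" by metis
    have "(x, \<lambda>j. case prod_decode j of (n, i) \<Rightarrow> z n i) \<in> D" using z by (simp add: D_def)
    then show "x \<in> fst ` D" by force
  qed (use C(2) in \<open>force simp: D_def\<close>)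
  ultimately show ?thesis
    unfolding analytic_set_def by blast
qed

text \<open>In a metric space an open set is a countable union of closed sets.\<close>

lemma analytic_set_open:
  fixes A :: "'a::metric_space set"
  assumes "open A" shows "analytic_set A"
proof -
  have "fsigma_in euclidean A"
    using assms by (intro open_imp_fsigma_in) (auto simp: metrizable_space_euclidean)
  then obtain C :: "nat \<Rightarrow> 'a set" where "\<And>n. closed (C n)" "(\<Union>n. C n) = A"
    unfolding fsigma_in_ascending by auto
  then show ?thesis using analytic_set_UN analytic_set_closed by blast
qed

text \<open>Analytic sets are not closed under complements, so the induction carries a set together
  with its complement; the union step then uses countable unions for the one and countable
  intersections for the other.\<close>

lemma analytic_set_borel:
  fixes A :: "'a::metric_space set"
  assumes "A \<in> sets borel" shows "analytic_set A"
proof -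
  have "A \<in> sigma_sets UNIV {S. open S}" using assms by (simp add: sets_borel)
  then have "analytic_set A \<and> analytic_set (- A)"
  proof induction
    case (Basic a)
    then show ?case by (auto intro: analytic_set_open analytic_set_closed)
  next
    case Empty
    then show ?case by (auto intro: analytic_set_closed)
  next
    case (Compl a)
    then show ?case by (simp add: Compl_eq_Diff_UNIV[symmetric])
  next
    case (Union a)
    then show ?case using analytic_set_UN[of a] analytic_set_INT[of "\<lambda>n. - a n"] by simp
  qed
  then show ?thesis ..
qed

text \<open>Removing the basic open sets with countable projection leaves a closed set to which the
  Cantor scheme applies.\<close>

lemma uncountable_borel_contains_cantor:
  fixes A :: "real set"
  assumes "A \<in> sets borel" "uncountable A"
  shows "\<exists>k. cantor_map k \<and> range k \<subseteq> A"
proof -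
  obtain C :: "(real \<times> (nat \<Rightarrow> real)) set" where C: "closed C" "A = fst ` C"
    using analytic_set_borel[OF assms(1)] by (auto simp: analytic_set_def)
  obtain B :: "(real \<times> (nat \<Rightarrow> real)) set set" where B: "countable B" "topological_basis B"
    using ex_countable_basis by blast
  define N where "N = {V \<in> B. countable (fst ` (C \<inter> V))}"
  define C' where "C' = C - \<Union>N"
  have "open (\<Union>N)"
    using topological_basis_open[OF B(2)] by (auto simp: N_def)
  then have "closed C'" unfolding C'_def using C(1) by (rule closed_Diff[rotated])
  have "countable N" unfolding N_def using B(1) by simp
  then have "countable (\<Union>V\<in>N. fst ` (C \<inter> V))"
    by (rule countable_UN) (simp add: N_def)
  moreover have "fst ` (C \<inter> \<Union>N) = (\<Union>V\<in>N. fst ` (C \<inter> V))" by blast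
  ultimately have N: "countable (fst ` (C \<inter> \<Union>N))" by simp
  \<comment> \<open>The removed part projects to a countable set, so an uncountable projection over
    \<open>U\<close> survives the passage from \<open>C\<close> to \<open>C'\<close>.\<close>
  have unc: "uncountable (fst ` (C' \<inter> U))" if "uncountable (fst ` (C \<inter> U))" for U
  proof
    assume "countable (fst ` (C' \<inter> U))"
    then have "countable (fst ` (C' \<inter> U) \<union> fst ` (C \<inter> \<Union>N))" using N by blast
    moreover have "fst ` (C \<inter> U) \<subseteq> fst ` (C' \<inter> U) \<union> fst ` (C \<inter> \<Union>N)" by (auto simp: C'_def)
    ultimately show False using that countable_subset by blast
  qed
  have split: "\<exists>y\<in>C' \<inter> U. \<exists>z\<in>C' \<inter> U. fst y \<noteq> fst z" if U: "open U" "C' \<inter> U \<noteq> {}" for U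
  proof -
    obtain p where p: "p \<in> C'" "p \<in> U" using U by blast
    obtain V where V: "V \<in> B" "p \<in> V" "V \<subseteq> U" using topological_basisE[OF B(2) U(1) p(2)] by blast
    \<comment> \<open>Since \<open>p\<close> was not removed, its basic neighbourhood
      \<open>V\<close> has uncountable projection, hence contains points of \<open>C'\<close> with a
      first coordinate other than that of \<open>p\<close>.\<close>
    have "V \<notin> N" using p V by (auto simp: C'_def)
    then have "uncountable (fst ` (C' \<inter> V))" using V unc by (simp add: N_def)
    then have "\<not> fst ` (C' \<inter> V) \<subseteq> {fst p}"
      by (meson countable_empty countable_insert countable_subset)
    then show ?thesis using V p by auto
  qed
  have "C' \<noteq> {}"
    using unc[of UNIV] assms(2) C(2) by auto
  then have "\<exists>k. cantor_map k \<and> range k \<subseteq> fst ` C'"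
    using \<open>closed C'\<close> split by (intro cantor_scheme) (auto intro: continuous_intros)
  moreover have "fst ` C' \<subseteq> A" using C(2) by (auto simp: C'_def)
  ultimately show ?thesis by blast
qed

section \<open>Copies of a linear order and perfect sets\<close>

definition cantor_sets :: "real set \<Rightarrow> real set set" where
  "cantor_sets L = {range k | k. cantor_map k \<and> range k \<subseteq> L}"

text \<open>A closed set is determined by the members of a countable base that miss it. This bounds
  families of Cantor sets by the continuum.\<close>

lemma closed_sets_lepoll: "{S :: real set. closed S} \<lesssim> (UNIV :: (nat \<Rightarrow> bool) set)"
proof -
  obtain B :: "real set set" where B: "countable B" "topological_basis B"
    using ex_countable_basis by blast
  define f where "f S n \<longleftrightarrow> from_nat_into B n \<inter> S = {}" for S :: "real set" and n
  have "S \<subseteq> S'" if cl: "closed S'" and eq: "f S = f S'" for S S'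
  proof (rule ccontr)
    assume "\<not> S \<subseteq> S'"
    then obtain x where x: "x \<in> S" "x \<in> - S'" by blast
    obtain V where V: "V \<in> B" "x \<in> V" "V \<subseteq> - S'"
      using topological_basisE[OF B(2) open_Compl[OF cl] x(2)] by blast
    obtain n where n: "from_nat_into B n = V"
      using from_nat_into_surj[OF B(1) V(1)] by blast
    have "f S' n" using V n by (auto simp: f_def)
    moreover have "\<not> f S n" using V n x by (auto simp: f_def)
    ultimately show False using eq by simp
  qed
  then have "inj_on f {S. closed S}" by (intro inj_onI) (simp add: subset_antisym)
  then show ?thesis by (auto simp: lepoll_def)
qed

lemma cantor_sets_closed: "a \<in> cantor_sets L \<Longrightarrow> closed a"
  by (auto simp: cantor_sets_def cantor_map_range compact_imp_closed)

section \<open>Maximal almost disjoint families of Cantor sets\<close>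

definition almost_disjoint :: "real set set \<Rightarrow> bool" where
  "almost_disjoint A \<longleftrightarrow> (\<forall>a\<in>A. \<forall>b\<in>A. \<forall>T. perfect T \<longrightarrow> T \<subseteq> a \<longrightarrow> T \<subseteq> b \<longrightarrow> a = b)"

text \<open>A maximal antichain of Sacks conditions among the Cantor subsets of \<open>L\<close>:
  almost disjointness is pairwise incompatibility, and maximality is expressed as
  predensity.\<close>

definition maximal_cantor_family :: "real set \<Rightarrow> real set set \<Rightarrow> bool" where
  "maximal_cantor_family L A \<longleftrightarrow>
     A \<subseteq> cantor_sets L \<and> almost_disjoint A \<and>
     (\<forall>c\<in>cantor_sets L. \<exists>a\<in>A. \<exists>T. perfect T \<and> T \<subseteq> a \<and> T \<subseteq> c)"

text \<open>Zorn's lemma is applied above the continuum many disjoint Cantor sets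
  \<open>K x\<close>, which fixes the lower bound on the size; the number of closed sets gives the
  upper one. Having the same size for every \<open>L\<close> is what allows two such families to be
  matched.\<close>

lemma exists_maximal_cantor_family:
  assumes "perfect P" "P \<subseteq> L"
  shows "\<exists>A. maximal_cantor_family L A \<and> A \<approx> (UNIV :: (nat \<Rightarrow> bool) set)"
proof -
  obtain k where k: "cantor_map k" "range k \<subseteq> P" using perfect_contains_cantor[OF assms(1)] by blast
  define K where "K x = range (\<lambda>b. k (interleave x b))" for x
  have Kdisj: "x = y" if "K x \<inter> K y \<noteq> {}" for x y
    using that injD[OF cantor_map_inj[OF k(1)]] by (auto simp: K_def dest!: interleave_inj)
  have KL: "K x \<in> cantor_sets L" for x
    using cantor_map_interleave[OF k(1), of x] k(2) assms(2) unfolding cantor_sets_def K_def by blast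
  have Kad: "almost_disjoint (range K)"
    unfolding almost_disjoint_def
  proof (intro ballI allI impI)
    fix a b T assume "a \<in> range K" "b \<in> range K" "perfect T" "T \<subseteq> a" "T \<subseteq> b"
    moreover have "T \<noteq> {}" using \<open>perfect T\<close> by (simp add: perfect_def)
    ultimately show "a = b" using Kdisj by blast
  qed
  define \<A> where "\<A> = {A. range K \<subseteq> A \<and> A \<subseteq> cantor_sets L \<and> almost_disjoint A}"
  have "\<exists>M\<in>\<A>. \<forall>X\<in>\<A>. M \<subseteq> X \<longrightarrow> X = M"
  proof (rule subset_Zorn_nonempty)
    have "range K \<in> \<A>" unfolding \<A>_def using KL Kad by (simp add: image_subset_iff)
    then show "\<A> \<noteq> {}" by blast
    fix \<C> assume C: "\<C> \<noteq> {}" "subset.chain \<A> \<C>"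
    then have sub: "\<C> \<subseteq> \<A>" and chain: "\<And>A B. A \<in> \<C> \<Longrightarrow> B \<in> \<C> \<Longrightarrow> A \<subseteq> B \<or> B \<subseteq> A"
      unfolding subset_chain_def by blast+
    have "almost_disjoint (\<Union>\<C>)"
      unfolding almost_disjoint_def
    proof (intro ballI allI impI)
      fix a b T assume ab: "a \<in> \<Union>\<C>" "b \<in> \<Union>\<C>" "perfect T" "T \<subseteq> a" "T \<subseteq> b"
      then obtain A where A: "A \<in> \<C>" "a \<in> A" "b \<in> A"
        using chain by (meson UnionE subsetD)
      then have "almost_disjoint A" using sub by (auto simp: \<A>_def)
      then show "a = b" using ab A unfolding almost_disjoint_def by blast
    qed
    then show "\<Union>\<C> \<in> \<A>" using sub C(1) unfolding \<A>_def by blast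
  qed
  then obtain A where A: "A \<in> \<A>" and max: "\<And>X. X \<in> \<A> \<Longrightarrow> A \<subseteq> X \<Longrightarrow> X = A" by blast
  then have AL: "range K \<subseteq> A" "A \<subseteq> cantor_sets L" "almost_disjoint A" by (auto simp: \<A>_def)
  have "\<exists>a\<in>A. \<exists>T. perfect T \<and> T \<subseteq> a \<and> T \<subseteq> c" if c: "c \<in> cantor_sets L" for c
  proof (rule ccontr)
    assume *: "\<not> ?thesis"
    have "perfect c" using c by (auto simp: cantor_sets_def cantor_map_range)
    \<comment> \<open>A member of \<open>A\<close> equal to \<open>c\<close> would share the perfect
      set \<open>c\<close> with it.\<close>
    with * have "c \<notin> A" by blast
    moreover have "almost_disjoint (insert c A)"
      using AL(3) * unfolding almost_disjoint_def by blast
    then have "insert c A \<in> \<A>" using AL c by (auto simp: \<A>_def)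
    ultimately show False using max[of "insert c A"] by blast
  qed
  then have "maximal_cantor_family L A" using AL by (simp add: maximal_cantor_family_def)
  moreover have "A \<lesssim> (UNIV :: (nat \<Rightarrow> bool) set)"
  proof (rule lepoll_trans[OF subset_imp_lepoll closed_sets_lepoll])
    show "A \<subseteq> {S. closed S}" using AL cantor_sets_closed by blast
  qed
  moreover have "inj K"
    by (rule injI) (use Kdisj in \<open>force simp: K_def\<close>)
  then have "(UNIV :: (nat \<Rightarrow> bool) set) \<lesssim> A"
    using AL(1) by (auto simp: lepoll_def)
  ultimately show ?thesis using lepoll_antisym by blast
qed

section \<open>Transfer of perfect sets between Cantor sets\<close>

definition cantor_transfer ::
  "((nat \<Rightarrow> bool) \<Rightarrow> real) \<Rightarrow> ((nat \<Rightarrow> bool) \<Rightarrow> real) \<Rightarrow> real set \<Rightarrow> real set" where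
  "cantor_transfer k k' T = (\<lambda>x. k' (inv k x)) ` T"

text \<open>By compactness of the Cantor space \<open>inv k\<close> is continuous on
  \<open>range k\<close>, so the transferring map is a homeomorphism onto
  \<open>range k'\<close>.\<close>

lemma cantor_transfer_perfect:
  assumes k: "cantor_map k" and k': "cantor_map k'" and T: "perfect T" "T \<subseteq> range k"
  shows "perfect (cantor_transfer k k' T)"
  unfolding cantor_transfer_def
proof (rule perfect_image[OF T(1)])
  show "compact T"
    using T cantor_map_range(2)[OF k] closed_Int_compact[of T "range k"]
    by (simp add: perfect_def inf_absorb1)
  have "continuous_on (range k) (inv k)"
    using k compact_binary_sequences
    by (intro continuous_on_inv) (auto simp: cantor_map_def cantor_map_inj[OF k])
  then show "continuous_on T (\<lambda>x. k' (inv k x))"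
    using k' T by (intro continuous_on_compose2[of UNIV k' T "inv k"])
      (auto simp: cantor_map_def intro: continuous_on_subset)
  show "inj_on (\<lambda>x. k' (inv k x)) T"
    using T(2) by (intro inj_onI) (metis cantor_map_inj[OF k'] f_inv_into_f injD subsetD)
qed

lemma cantor_transfer_back:
  assumes "cantor_map k" "cantor_map k'" "T \<subseteq> range k"
  shows "cantor_transfer k' k (cantor_transfer k k' T) = T"
proof -
  have "k (inv k' (k' (inv k x))) = x" if "x \<in> T" for x
    using that assms(3) by (metis cantor_map_inj[OF assms(2)] f_inv_into_f inv_f_f subsetD)
  then show ?thesis by (auto simp: cantor_transfer_def image_image)
qed

lemma cantor_transfer_range: "cantor_transfer k k' T \<subseteq> range k'"
  by (auto simp: cantor_transfer_def)

lemma cantor_transfer_mono: "T \<subseteq> T' \<Longrightarrow> cantor_transfer k k' T \<subseteq> cantor_transfer k k' T'"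
  by (auto simp: cantor_transfer_def)

definition perfect_below :: "real set set \<Rightarrow> real set set" where
  "perfect_below A = {T. perfect T \<and> (\<exists>a\<in>A. T \<subseteq> a)}"

text \<open>Almost disjointness leaves exactly one member of \<open>A\<close> above each perfect
  \<open>T\<close> below the family. So \<open>T\<close> can be moved by a homeomorphism from that
  member to the matched member of \<open>B\<close>, without conflict between different
  members.\<close>

lemma perfect_below_iso:
  assumes A: "A \<subseteq> cantor_sets L" "almost_disjoint A"
    and B: "B \<subseteq> cantor_sets M" "almost_disjoint B" and "A \<approx> B"
  shows "relation_of (\<subseteq>) (perfect_below A) \<cong>\<^sub>o relation_of (\<subseteq>) (perfect_below B)"
proof -
  obtain \<beta> where \<beta>: "bij_betw \<beta> A B" using assms(5) by (auto simp: eqpoll_def)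
  have \<beta>B: "\<beta> a \<in> B" if "a \<in> A" for a using \<beta> that by (rule bij_betwE[THEN bspec])
  have "\<forall>a\<in>A. \<exists>k. cantor_map k \<and> a = range k" "\<forall>a\<in>B. \<exists>k. cantor_map k \<and> a = range k"
    using A(1) B(1) by (auto simp: cantor_sets_def)
  then obtain k l where k: "\<And>a. a \<in> A \<Longrightarrow> cantor_map (k a)" "\<And>a. a \<in> A \<Longrightarrow> range (k a) = a"
    and l: "\<And>b. b \<in> B \<Longrightarrow> cantor_map (l b)" "\<And>b. b \<in> B \<Longrightarrow> range (l b) = b"
    by metis
  have "\<forall>T\<in>perfect_below A. \<exists>a. a \<in> A \<and> T \<subseteq> a" by (auto simp: perfect_below_def)
  then obtain \<alpha> where \<alpha>: "\<And>T. T \<in> perfect_below A \<Longrightarrow> \<alpha> T \<in> A" "\<And>T. T \<in> perfect_below A \<Longrightarrow> T \<subseteq> \<alpha> T"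
    by metis
  \<comment> \<open>A perfect \<open>S\<close> inside \<open>T\<close> suffices to recognise the
    member above \<open>T\<close>. Taking \<open>S\<close> smaller than \<open>T\<close> shows that
    nested sets have the same member; taking \<open>S = T\<close> gives uniqueness.\<close>
  have \<alpha>_eq: "\<alpha> T = a" if "T \<in> perfect_below A" "a \<in> A" "S \<subseteq> T" "S \<subseteq> a" "perfect S" for T S a
    using A(2) \<alpha>[OF that(1)] that unfolding almost_disjoint_def by blast
  define \<Phi> where "\<Phi> T = cantor_transfer (k (\<alpha> T)) (l (\<beta> (\<alpha> T))) T" for T
  have perf: "perfect T" if "T \<in> perfect_below A" for T using that by (simp add: perfect_below_def)
  have \<Phi>: "perfect (\<Phi> T)" "\<Phi> T \<subseteq> \<beta> (\<alpha> T)"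
    "cantor_transfer (l (\<beta> (\<alpha> T))) (k (\<alpha> T)) (\<Phi> T) = T" if T: "T \<in> perfect_below A" for T
  proof -
    have *: "cantor_map (k (\<alpha> T))" "cantor_map (l (\<beta> (\<alpha> T)))" "T \<subseteq> range (k (\<alpha> T))"
      using \<alpha>[OF T] k l \<beta>B by auto
    show "perfect (\<Phi> T)" unfolding \<Phi>_def using cantor_transfer_perfect[OF *(1,2) perf[OF T] *(3)] .
    show "\<Phi> T \<subseteq> \<beta> (\<alpha> T)" unfolding \<Phi>_def
      using cantor_transfer_range[of "k (\<alpha> T)" "l (\<beta> (\<alpha> T))" T] l(2)[OF \<beta>B[OF \<alpha>(1)[OF T]]] by simp
    show "cantor_transfer (l (\<beta> (\<alpha> T))) (k (\<alpha> T)) (\<Phi> T) = T"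
      unfolding \<Phi>_def using * by (rule cantor_transfer_back)
  qed
  have \<Phi>B: "\<Phi> T \<in> perfect_below B" if T: "T \<in> perfect_below A" for T
    using \<Phi>[OF T] \<beta>B[OF \<alpha>(1)[OF T]] by (auto simp: perfect_below_def)
  have le: "S \<subseteq> T \<longleftrightarrow> \<Phi> S \<subseteq> \<Phi> T" if S: "S \<in> perfect_below A" and T: "T \<in> perfect_below A" for S T
  proof
    assume "S \<subseteq> T"
    then have "\<alpha> T = \<alpha> S" using \<alpha>_eq[OF T \<alpha>(1)[OF S] _ \<alpha>(2)[OF S] perf[OF S]] by simp
    then show "\<Phi> S \<subseteq> \<Phi> T" using \<open>S \<subseteq> T\<close> by (simp add: \<Phi>_def cantor_transfer_mono)
  next
    assume *: "\<Phi> S \<subseteq> \<Phi> T"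
    \<comment> \<open>The perfect set \<open>\<Phi> S\<close> now lies below two members of
      \<open>B\<close>, which therefore coincide, so both sets are pulled back by the same
      homeomorphism.\<close>
    have "\<Phi> S \<subseteq> \<beta> (\<alpha> T)" using * \<Phi>(2)[OF T] by blast
    then have "\<beta> (\<alpha> S) = \<beta> (\<alpha> T)"
      using B(2) \<Phi>[OF S] \<beta>B[OF \<alpha>(1)[OF S]] \<beta>B[OF \<alpha>(1)[OF T]] unfolding almost_disjoint_def by blast
    then have "\<alpha> S = \<alpha> T" using \<beta> \<alpha>(1) S T by (meson bij_betw_imp_inj_on inj_onD)
    then show "S \<subseteq> T"
      using cantor_transfer_mono[OF *, of "l (\<beta> (\<alpha> T))" "k (\<alpha> T)"] \<Phi>(3)[OF S] \<Phi>(3)[OF T] by simp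
  qed
  have surj: "\<exists>T\<in>perfect_below A. \<Phi> T = U" if U: "U \<in> perfect_below B" for U
  proof -
    obtain b where b: "b \<in> B" "U \<subseteq> b" "perfect U" using U by (auto simp: perfect_below_def)
    obtain a where a: "a \<in> A" "\<beta> a = b" using \<beta> b(1) by (auto simp: bij_betw_def)
    let ?T = "cantor_transfer (l b) (k a) U"
    have Ub: "U \<subseteq> range (l b)" using l(2) b by simp
    have pT: "perfect ?T" using cantor_transfer_perfect[OF l(1) k(1) b(3) Ub] a b by simp
    moreover have Ta: "?T \<subseteq> a" using cantor_transfer_range[of "l b" "k a" U] k(2)[OF a(1)] by simp
    ultimately have T: "?T \<in> perfect_below A" using a by (auto simp: perfect_below_def)
    then have "\<alpha> ?T = a" using \<alpha>_eq[OF T a(1) order_refl Ta pT] by simp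
    then have "\<Phi> ?T = U"
      unfolding \<Phi>_def using a cantor_transfer_back[OF l(1)[OF b(1)] k(1)[OF a(1)] Ub] by simp
    then show ?thesis using T by blast
  qed
  have "bij_betw \<Phi> (perfect_below A) (perfect_below B)"
    unfolding bij_betw_def
  proof
    show "inj_on \<Phi> (perfect_below A)"
      using le by (intro inj_onI) (metis order_refl subset_antisym)
    show "\<Phi> ` perfect_below A = perfect_below B" using \<Phi>B surj by blast
  qed
  then show ?thesis
    unfolding order_isomorphic_def using le \<Phi>B
    by (intro exI[of _ \<Phi>]) (simp add: Field_relation_of, simp add: relation_of_def)
qed

text \<open>Predensity of \<open>A\<close> yields a perfect set inside both \<open>range k\<close>
  and a member of \<open>A\<close>.\<close>

lemma perfect_below_dense:
  assumes A: "maximal_cantor_family L A" and "cantor_map k" "range k \<subseteq> L" "range k \<subseteq> x"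
  shows "\<exists>T\<in>perfect_below A. T \<subseteq> x"
proof -
  have "range k \<in> cantor_sets L" using assms by (auto simp: cantor_sets_def)
  then obtain a T where "a \<in> A" "perfect T" "T \<subseteq> a" "T \<subseteq> range k"
    using A unfolding maximal_cantor_family_def by blast
  then have "T \<in> perfect_below A" "T \<subseteq> x" using assms(4) by (auto simp: perfect_below_def)
  then show ?thesis ..
qed

lemma perfect_below_subset:
  assumes "maximal_cantor_family L A"
  shows "perfect_below A \<subseteq> {T. perfect T \<and> T \<subseteq> L}"
  using assms by (auto simp: maximal_cantor_family_def perfect_below_def cantor_sets_def) blast

text \<open>Following \<open>rational_cut\<close> by a Cantor map into \<open>P\<close> embeds all
  reals in order into \<open>P\<close>. Restricted to \<open>L\<close> this is a self-embedding,
  because \<open>P\<close> lies in \<open>L\<close>.\<close>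

lemma exists_copy_in_perfect:
  fixes P L :: "real set"
  assumes "perfect P" "P \<subseteq> L"
  shows "\<exists>C\<in>copies L. C \<subseteq> P"
proof -
  obtain k where k: "cantor_map k" "range k \<subseteq> P" using perfect_contains_cantor[OF assms(1)] by blast
  let ?f = "\<lambda>x. k (rational_cut x)"
  have "strict_mono_on L ?f"
    using k(1) lex_less_rational_cut by (auto simp: strict_mono_on_def cantor_map_def)
  then have "?f ` L \<in> copies L" using k(2) assms(2) by (auto simp: copies_def)
  moreover have "?f ` L \<subseteq> P" using k(2) by auto
  ultimately show ?thesis ..
qed

lemma copy_contains_cantor:
  fixes P L :: "real set"
  assumes "perfect P" "P \<subseteq> L" "C \<in> copies L"
  shows "\<exists>k. cantor_map k \<and> range k \<subseteq> C"
proof -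
  obtain f where f: "C = f ` L" "strict_mono_on L f" using assms(3) by (auto simp: copies_def)
  then have "strict_mono_on P f" using assms(2) by (auto simp: strict_mono_on_def)
  then obtain k where "cantor_map k" "range k \<subseteq> f ` P"
    using perfect_strict_mono_image[OF assms(1)] by blast
  moreover have "f ` P \<subseteq> C" unfolding f(1) using assms(2) by (rule image_mono)
  ultimately show ?thesis by blast
qed

lemma copy_algebra_iso_sacks:
  fixes P L :: "real set"
  assumes P: "perfect P" "P \<subseteq> L"
  shows "copy_algebra L \<cong>\<^sub>o ro sacks"
proof -
  let ?r = "\<lambda>F. relation_of (\<subseteq>) (F :: real set set)"
  \<comment> \<open>In general neither family contains the other: a copy need not be closed, and a
    perfect set need not be a copy. They are compared as dense parts of their union.\<close>
  define X where "X = copies L \<union> {T. perfect T \<and> T \<subseteq> L}"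
  obtain A where A: "maximal_cantor_family L A" "A \<approx> (UNIV :: (nat \<Rightarrow> bool) set)"
    using exists_maximal_cantor_family[OF P] by blast
  obtain B where B: "maximal_cantor_family UNIV B" "B \<approx> (UNIV :: (nat \<Rightarrow> bool) set)"
    using exists_maximal_cantor_family[OF P(1) subset_UNIV] by blast
  have sub_L: "x \<subseteq> L" if "x \<in> X" for x
    using that by (auto simp: X_def copies_def)
  have cantor: "\<exists>k. cantor_map k \<and> range k \<subseteq> x" if "x \<in> X" for x
    using that copy_contains_cantor[OF P] perfect_contains_cantor by (auto simp: X_def)
  have "ro (?r (copies L)) \<cong>\<^sub>o copy_algebra L"
    unfolding copy_algebra_def by (rule ro_sq_iso[OF refl_on_relation_of_subset trans_relation_of_subset])
  then have "copy_algebra L \<cong>\<^sub>o ro (?r (copies L))" by (rule order_isomorphic_sym)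
  also have "ro (?r (copies L)) \<cong>\<^sub>o ro (?r X)"
  proof (rule ro_iso_of_dense_subfamily)
    show "\<exists>d\<in>copies L. d \<subseteq> x" if "x \<in> X" for x
      using that exists_copy_in_perfect by (auto simp: X_def)
  qed (simp add: X_def)
  also have "ro (?r X) \<cong>\<^sub>o ro (?r (perfect_below A))"
  proof (rule order_isomorphic_sym, rule ro_iso_of_dense_subfamily)
    show "\<exists>d\<in>perfect_below A. d \<subseteq> x" if x: "x \<in> X" for x
    proof -
      obtain k where "cantor_map k" "range k \<subseteq> x" using cantor[OF x] by blast
      with sub_L[OF x] show ?thesis by (intro perfect_below_dense[OF A(1)]) auto
    qed
  qed (use perfect_below_subset[OF A(1)] in \<open>auto simp: X_def\<close>)
  \<comment> \<open>Here \<open>L\<close> is exchanged for the whole line; the other links are a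
    separative quotient and dense inclusions.\<close>
  also have "ro (?r (perfect_below A)) \<cong>\<^sub>o ro (?r (perfect_below B))"
  proof (rule ro_iso_of_order_iso)
    have "A \<approx> B" using A(2) B(2) by (meson eqpoll_sym eqpoll_trans)
    then show "?r (perfect_below A) \<cong>\<^sub>o ?r (perfect_below B)"
      using A(1) B(1) by (intro perfect_below_iso) (auto simp: maximal_cantor_family_def)
  qed (rule refl_on_relation_of_subset trans_relation_of_subset)+
  also have "ro (?r (perfect_below B)) \<cong>\<^sub>o ro sacks"
    unfolding sacks_def
  proof (rule ro_iso_of_dense_subfamily)
    show "\<exists>d\<in>perfect_below B. d \<subseteq> x" if "x \<in> {S. perfect S}" for x
      using that perfect_contains_cantor perfect_below_dense[OF B(1)] by blast
  qed (auto simp: perfect_below_def)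
  finally show ?thesis .
qed

section \<open>Borel sets modulo countable sets\<close>

lemma refl_eq_mod_countable: "A \<in> sets borel \<Longrightarrow> (A, A) \<in> eq_mod_countable"
  by (simp add: eq_mod_countable_def)

text \<open>Changing representatives alters the difference \<open>A - B\<close> only by countable
  sets.\<close>

lemma mem_borel_mod_countable_iff:
  assumes "A \<in> sets borel" "B \<in> sets borel"
  shows "(eq_mod_countable `` {A}, eq_mod_countable `` {B}) \<in> borel_mod_countable \<longleftrightarrow> countable (A - B)"
proof
  assume "(eq_mod_countable `` {A}, eq_mod_countable `` {B}) \<in> borel_mod_countable"
  then obtain A' B' where *: "eq_mod_countable `` {A} = eq_mod_countable `` {A'}"
    "eq_mod_countable `` {B} = eq_mod_countable `` {B'}" "countable (A' - B')"
    unfolding borel_mod_countable_def by blast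
  have "A \<in> eq_mod_countable `` {A'}" "B \<in> eq_mod_countable `` {B'}"
    using refl_eq_mod_countable assms * by blast+
  then have "countable (sym_diff A' A \<union> sym_diff B' B \<union> (A' - B'))"
    using *(3) by (auto simp: eq_mod_countable_def)
  moreover have "A - B \<subseteq> sym_diff A' A \<union> sym_diff B' B \<union> (A' - B')" by blast
  ultimately show "countable (A - B)" by (rule countable_subset[rotated])
qed (use assms in \<open>auto simp: borel_mod_countable_def\<close>)

lemma Field_borel_mod_countable:
  "Field borel_mod_countable = (\<lambda>A. eq_mod_countable `` {A}) ` sets borel"
proof
  show "(\<lambda>A. eq_mod_countable `` {A}) ` sets borel \<subseteq> Field borel_mod_countable"
  proof (rule image_subsetI)
    fix A :: "real set" assume A: "A \<in> sets borel"
    have "(eq_mod_countable `` {A}, eq_mod_countable `` {A}) \<in> borel_mod_countable"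
      by (simp add: mem_borel_mod_countable_iff[OF A A])
    then show "eq_mod_countable `` {A} \<in> Field borel_mod_countable" by (rule FieldI1)
  qed
qed (auto simp: borel_mod_countable_def Field_def)

lemma mem_nonzero_borel_iff:
  "(x, y) \<in> nonzero borel_mod_countable \<longleftrightarrow>
     (\<exists>A B. A \<in> sets borel \<and> B \<in> sets borel \<and> uncountable A \<and> uncountable B \<and> countable (A - B) \<and>
        x = eq_mod_countable `` {A} \<and> y = eq_mod_countable `` {B})"
proof -
  \<comment> \<open>Comparison with the class of the empty set shows that only classes of countable
    sets can be zero.\<close>
  have zero: "(\<forall>x\<in>Field borel_mod_countable. (eq_mod_countable `` {A}, x) \<in> borel_mod_countable) \<longleftrightarrow> countable A"
    if A: "A \<in> sets borel" for A
  proof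
    assume "\<forall>x\<in>Field borel_mod_countable. (eq_mod_countable `` {A}, x) \<in> borel_mod_countable"
    then have "(eq_mod_countable `` {A}, eq_mod_countable `` {{}}) \<in> borel_mod_countable"
      by (simp add: Field_borel_mod_countable)
    then show "countable A" using mem_borel_mod_countable_iff[OF A, of "{}"] by simp
  next
    assume "countable A"
    then show "\<forall>x\<in>Field borel_mod_countable. (eq_mod_countable `` {A}, x) \<in> borel_mod_countable"
      by (auto simp: Field_borel_mod_countable mem_borel_mod_countable_iff[OF A])
  qed
  show ?thesis
  proof
    assume xy: "(x, y) \<in> nonzero borel_mod_countable"
    then obtain A B where AB: "A \<in> sets borel" "B \<in> sets borel"
      "x = eq_mod_countable `` {A}" "y = eq_mod_countable `` {B}"
      unfolding nonzero_def Field_borel_mod_countable by auto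
    have "uncountable A" "uncountable B" "countable (A - B)"
      using xy zero[OF AB(1)] zero[OF AB(2)] mem_borel_mod_countable_iff[OF AB(1,2)]
      unfolding nonzero_def AB(3,4) by auto
    with AB show "\<exists>A B. A \<in> sets borel \<and> B \<in> sets borel \<and> uncountable A \<and> uncountable B \<and>
        countable (A - B) \<and> x = eq_mod_countable `` {A} \<and> y = eq_mod_countable `` {B}" by blast
  next
    assume "\<exists>A B. A \<in> sets borel \<and> B \<in> sets borel \<and> uncountable A \<and> uncountable B \<and>
        countable (A - B) \<and> x = eq_mod_countable `` {A} \<and> y = eq_mod_countable `` {B}"
    then obtain A B where AB: "A \<in> sets borel" "B \<in> sets borel" "uncountable A" "uncountable B"
      "countable (A - B)" and xy: "x = eq_mod_countable `` {A}" "y = eq_mod_countable `` {B}"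
      by blast
    have "x \<in> Field borel_mod_countable" "y \<in> Field borel_mod_countable"
      using AB by (auto simp: Field_borel_mod_countable xy)
    moreover have "\<not> (\<forall>w\<in>Field borel_mod_countable. (x, w) \<in> borel_mod_countable)"
      "\<not> (\<forall>w\<in>Field borel_mod_countable. (y, w) \<in> borel_mod_countable)"
      unfolding xy using zero AB by simp_all
    ultimately show "(x, y) \<in> nonzero borel_mod_countable"
      using mem_borel_mod_countable_iff[OF AB(1,2)] AB(5) unfolding nonzero_def xy by simp
  qed
qed

lemma Field_nonzero_borel:
  "Field (nonzero borel_mod_countable) = (\<lambda>A. eq_mod_countable `` {A}) ` {A \<in> sets borel. uncountable A}"
proof
  show "(\<lambda>A. eq_mod_countable `` {A}) ` {A \<in> sets borel. uncountable A} \<subseteq> Field (nonzero borel_mod_countable)"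
  proof (rule image_subsetI)
    fix A :: "real set" assume "A \<in> {A \<in> sets borel. uncountable A}"
    then have "(eq_mod_countable `` {A}, eq_mod_countable `` {A}) \<in> nonzero borel_mod_countable"
      unfolding mem_nonzero_borel_iff by (intro exI[of _ A]) auto
    then show "eq_mod_countable `` {A} \<in> Field (nonzero borel_mod_countable)" by (rule FieldI1)
  qed
qed (auto simp: Field_def mem_nonzero_borel_iff)

lemma nonzero_borel_le_iff:
  assumes "A \<in> sets borel" "B \<in> sets borel" "uncountable A" "uncountable B"
  shows "(eq_mod_countable `` {A}, eq_mod_countable `` {B}) \<in> nonzero borel_mod_countable \<longleftrightarrow> countable (A - B)"
proof
  assume "(eq_mod_countable `` {A}, eq_mod_countable `` {B}) \<in> nonzero borel_mod_countable"
  then show "countable (A - B)"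
    using mem_borel_mod_countable_iff[OF assms(1,2)] by (simp add: nonzero_def)
qed (use assms mem_nonzero_borel_iff in blast)

text \<open>Perfect sets are uncountable, so their classes are nonzero. If the class of an
  uncountable Borel \<open>A\<close> lies below those of \<open>p\<close> and \<open>q\<close>, then
  \<open>A \<inter> p \<inter> q\<close> is still uncountable and Borel; a perfect subset of it
  witnesses compatibility. Density comes from the same perfect set theorem.\<close>

lemma sacks_iso_borel: "ro sacks \<cong>\<^sub>o ro (nonzero borel_mod_countable)"
proof (rule ro_iso_of_dense_map[where e = "\<lambda>P. eq_mod_countable `` {P}"])
  let ?n = "nonzero borel_mod_countable" and ?c = "\<lambda>A. eq_mod_countable `` {A}"
  show "refl_on (Field sacks) sacks" "trans sacks"
    unfolding sacks_def by (rule refl_on_relation_of_subset trans_relation_of_subset)+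
  have Fs: "Field sacks = {S. perfect S}" by (simp add: sacks_def Field_relation_of)
  have perfectD: "S \<in> sets borel" "uncountable S" if "perfect S" for S :: "real set"
    using that perfect_uncountable by (auto simp: perfect_def)
  have perfectI: "\<exists>T. perfect T \<and> T \<subseteq> S" if "S \<in> sets borel" "uncountable S" for S :: "real set"
    using uncountable_borel_contains_cantor[OF that] cantor_map_range by blast
  show "refl_on (Field ?n) ?n"
    by (auto simp: refl_on_def Field_nonzero_borel nonzero_borel_le_iff)
  show "trans ?n"
  proof (rule transI)
    fix x y z assume xy: "(x, y) \<in> ?n" and yz: "(y, z) \<in> ?n"
    have rep: "\<exists>A. A \<in> sets borel \<and> uncountable A \<and> w = ?c A" if "w \<in> Field ?n" for w
      using that unfolding Field_nonzero_borel by blast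
    obtain A B C where AB: "A \<in> sets borel" "B \<in> sets borel" "C \<in> sets borel"
      "uncountable A" "uncountable B" "uncountable C" "x = ?c A" "y = ?c B" "z = ?c C"
      using rep[OF FieldI1[OF xy]] rep[OF FieldI1[OF yz]] rep[OF FieldI2[OF yz]] by blast
    then have "countable ((A - B) \<union> (B - C))" using xy yz by (simp add: nonzero_borel_le_iff)
    moreover have "A - C \<subseteq> (A - B) \<union> (B - C)" by blast
    ultimately have "countable (A - C)" by (rule countable_subset[rotated])
    then show "(x, z) \<in> ?n" using AB by (simp add: nonzero_borel_le_iff)
  qed
  show "(?c p, ?c q) \<in> ?n" if "(p, q) \<in> sacks" for p q
  proof -
    have pq: "perfect p" "perfect q" "p - q = {}" using that by (auto simp: sacks_def relation_of_def)
    have "countable (p - q)" unfolding pq(3) by simp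
    then show ?thesis using pq(1,2) perfectD nonzero_borel_le_iff by simp
  qed
  show "\<exists>u. (u, p) \<in> sacks \<and> (u, q) \<in> sacks"
    if pq: "p \<in> Field sacks" "q \<in> Field sacks" and t: "(t, ?c p) \<in> ?n" "(t, ?c q) \<in> ?n" for p q t
  proof -
    have pq': "perfect p" "perfect q" using pq by (auto simp: Fs)
    have "t \<in> Field ?n" using t by (auto simp: Field_def)
    then obtain A where A: "A \<in> sets borel" "uncountable A" "t = ?c A" by (auto simp: Field_nonzero_borel)
    have "countable ((A - p) \<union> (A - q))"
      using t A pq' perfectD by (simp add: nonzero_borel_le_iff)
    then have "uncountable (A - ((A - p) \<union> (A - q)))" using A(2) by (rule uncountable_minus_countable[rotated])
    moreover have "A - ((A - p) \<union> (A - q)) = A \<inter> p \<inter> q" by blast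
    ultimately have unc: "uncountable (A \<inter> p \<inter> q)" by simp
    have "A \<inter> p \<inter> q \<in> sets borel" using A pq' perfectD by auto
    from perfectI[OF this unc] obtain T where "perfect T" "T \<subseteq> A \<inter> p \<inter> q" by auto
    then show ?thesis using pq' by (intro exI[of _ T]) (auto simp: sacks_def relation_of_def)
  qed
  show "\<exists>p\<in>Field sacks. (?c p, x) \<in> ?n" if x: "x \<in> Field ?n" for x
  proof -
    obtain A where A: "A \<in> sets borel" "uncountable A" "x = ?c A" using x by (auto simp: Field_nonzero_borel)
    obtain T where T: "perfect T" "T \<subseteq> A" using perfectI[OF A(1,2)] by blast
    then have "T - A = {}" by blast
    then have "countable (T - A)" by (metis countable_empty)
    then have "(?c T, x) \<in> ?n" using A perfectD[OF T(1)] by (simp add: nonzero_borel_le_iff)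
    then show ?thesis using T Fs by blast
  qed
qed

theorem theorem7p8:
  fixes L :: "real set"
  assumes "\<exists>P. perfect P \<and> P \<subseteq> L"
  shows "copy_algebra L \<cong>\<^sub>o copy_algebra (UNIV :: real set) \<and>
         copy_algebra (UNIV :: real set) \<cong>\<^sub>o ro sacks \<and>
         ro sacks \<cong>\<^sub>o ro (nonzero borel_mod_countable)"
proof -
  obtain P where P: "perfect P" "P \<subseteq> L" using assms by blast
  have "copy_algebra L \<cong>\<^sub>o ro sacks" by (rule copy_algebra_iso_sacks[OF P])
  \<comment> \<open>The real line is itself a suborder containing \<open>P\<close>, so both copy
    algebras are compared through Sacks forcing.\<close>
  moreover have R: "copy_algebra (UNIV :: real set) \<cong>\<^sub>o ro sacks"
    by (rule copy_algebra_iso_sacks[OF P(1) subset_UNIV])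
  ultimately have "copy_algebra L \<cong>\<^sub>o copy_algebra (UNIV :: real set)"
    using order_isomorphic_sym order_isomorphic_trans by blast
  then show ?thesis using R sacks_iso_borel by blast
qed

end
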